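(* Let $d\ge2$ and let $\omega\in\mathbb{R}^d$ satisfy the Bryuno condition $B(\omega)<\infty$, where $$B(\omega)=\sum_{n=0}^{\infty}\frac{1}{2^n}\log\frac{1}{\alpha_n(\omega)},\qquad \alpha_n(\omega)=\inf_{\nu\in\mathbb{Z}^d,\ 0<|\nu|\le 2^n}|\omega\cdot\nu|,\qquad |\nu|=|\nu_1|+\dots+|\nu_d|.$$ Let $g:\mathbb{R}\to\mathbb{R}$ be real analytic, and let $f:\mathbb{R}^d\to\mathbb{R}$ be real analytic and $2\pi$-periodic in each variable, with Fourier expansion $f(\psi)=\sum_{\nu\in\mathbb{Z}^d}e^{i\nu\cdot\psi}f_\nu$. Assume that there is $c_0\in\mathbb{R}$ such that $g(c_0)=f_0$ (the average of $f$) and $g'(c_0)\neq0$. Consider the ordinary differential equation $$\varepsilon\ddot x+\dot x+\varepsilon g(x)=\varepsilon f(\omega t).$$ Then there exists $\varepsilon_0>0$ such that for all real $\varepsilon$ with $|\varepsilon|<\varepsilon_0$ the equation has a quasi-periodic solution with frequency vector $\omega$. If moreover $g'(c_0)>0$, then, for $0<\varepsilon<\varepsilon_0$, such a solution is a local attractor.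
   Context: A solution is quasi-periodic with frequency vector $\omega$ if $x(t)=X(\omega t)$ with $X$ a continuous function on $\mathbb{R}^d$, $2\pi$-periodic in each variable. The condition $B(\omega)<\infty$ includes $\alpha_n(\omega)>0$ for all $n$. The last sentence of the claim refers to the quasi-periodic solution whose existence is asserted in the preceding sentence. Local attractor: all solutions $\tilde x(t)$ of the equation with initial data $(\tilde x(0),\dot{\tilde x}(0))$ sufficiently close to $(x(0),\dot x(0))$ exist for all $t\ge0$ and satisfy $|\tilde x(t)-x(t)|+|\dot{\tilde x}(t)-\dot x(t)|\to0$ as $t\to+\infty$. *)

theory Defs
  imports "HOL-Analysis.Analysis"
begin

definition real_vec :: "int ^ 'd \<Rightarrow> real ^ 'd" where
  "real_vec \<nu> = (\<chi> i. real_of_int (\<nu> $ i))"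

definition l1_norm :: "int ^ 'd \<Rightarrow> int" where
  "l1_norm \<nu> = (\<Sum>i\<in>UNIV. \<bar>\<nu> $ i\<bar>)"

definition bryuno_alpha :: "real ^ 'd \<Rightarrow> nat \<Rightarrow> real" where
  "bryuno_alpha \<omega> n =
     (INF \<nu>\<in>{\<nu> :: int ^ 'd. 0 < l1_norm \<nu> \<and> l1_norm \<nu> \<le> 2 ^ n}. \<bar>\<omega> \<bullet> real_vec \<nu>\<bar>)"

text \<open>
  Finiteness of the Bryuno sum. Since \<open>bryuno_alpha \<omega> n\<close> is nonincreasing in \<open>n\<close>, the terms are
  bounded below by a summable sequence, so the sum can only converge or diverge to \<open>+\<infinity>\<close>.
  Positivity is required separately because \<open>ln (1 / 0) = 0\<close>.
\<close>
definition bryuno_condition :: "real ^ 'd \<Rightarrow> bool" where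
  "bryuno_condition \<omega> \<longleftrightarrow>
     (\<forall>n. bryuno_alpha \<omega> n > 0) \<and>
     summable (\<lambda>n. 1 / 2 ^ n * ln (1 / bryuno_alpha \<omega> n))"

definition real_analytic :: "(real \<Rightarrow> real) \<Rightarrow> bool" where
  "real_analytic g \<longleftrightarrow>
     (\<forall>c. \<exists>a. \<exists>r>0. \<forall>y. \<bar>y - c\<bar> < r \<longrightarrow> (\<lambda>n. a n * (y - c) ^ n) sums g y)"

text \<open>
  In several variables the local power series is indexed by multi-indices \<open>k\<close>;
  \<open>has_sum\<close> is unconditional (equivalently, absolute) convergence.
\<close>
definition real_analytic_vec :: "(real ^ 'd \<Rightarrow> real) \<Rightarrow> bool" where
  "real_analytic_vec f \<longleftrightarrow>
     (\<forall>c. \<exists>a :: nat ^ 'd \<Rightarrow> real. \<exists>r>0. \<forall>y. (\<forall>i. \<bar>y $ i - c $ i\<bar> < r) \<longrightarrow>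
        ((\<lambda>k. a k * (\<Prod>i\<in>UNIV. (y $ i - c $ i) ^ (k $ i))) has_sum f y) UNIV)"

definition torus_periodic :: "(real ^ 'd \<Rightarrow> 'b) \<Rightarrow> bool" where
  "torus_periodic f \<longleftrightarrow> (\<forall>\<psi> i. f (\<psi> + axis i (2 * pi)) = f \<psi>)"

definition fourier_coeff :: "(real ^ 'd \<Rightarrow> real) \<Rightarrow> int ^ 'd \<Rightarrow> complex" where
  "fourier_coeff f \<nu> =
     integral (cbox 0 (\<chi> i. 2 * pi))
       (\<lambda>\<psi>. exp (- (\<i> * complex_of_real (real_vec \<nu> \<bullet> \<psi>))) * complex_of_real (f \<psi>))
     / (2 * pi) ^ CARD('d)"

text \<open>
  \<open>x\<close> with derivative \<open>v\<close> satisfies \<open>\<epsilon> x'' + x' + \<epsilon> g(x) = \<epsilon> f(\<omega> t)\<close> on the time interval \<open>T\<close>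
  (derivatives are one-sided at an endpoint belonging to \<open>T\<close>).
\<close>
definition solves_on ::
    "real \<Rightarrow> real ^ 'd \<Rightarrow> (real \<Rightarrow> real) \<Rightarrow> (real ^ 'd \<Rightarrow> real) \<Rightarrow> real set
      \<Rightarrow> (real \<Rightarrow> real) \<Rightarrow> (real \<Rightarrow> real) \<Rightarrow> bool" where
  "solves_on \<epsilon> \<omega> g f T x v \<longleftrightarrow>
     (\<forall>t\<in>T. (x has_real_derivative v t) (at t within T) \<and>
        (\<exists>a. (v has_real_derivative a) (at t within T) \<and>
             \<epsilon> * a + v t + \<epsilon> * g (x t) = \<epsilon> * f (t *\<^sub>R \<omega>)))"

definition quasi_periodic :: "real ^ 'd \<Rightarrow> (real \<Rightarrow> real) \<Rightarrow> bool" where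
  "quasi_periodic \<omega> x \<longleftrightarrow>
     (\<exists>X. continuous_on UNIV X \<and> torus_periodic X \<and> (\<forall>t. x t = X (t *\<^sub>R \<omega>)))"

text \<open>
  For initial data \<open>(a, b)\<close> near \<open>(x 0, v 0)\<close> there is a solution \<open>(y, w)\<close> on \<open>[0, \<infinity>)\<close>, any solution
  with these data on any \<open>[0, \<tau>)\<close> is a restriction of it (so all solutions with these data exist
  for all \<open>t \<ge> 0\<close>), and it converges to \<open>(x, v)\<close>.
\<close>
definition local_attractor ::
    "real \<Rightarrow> real ^ 'd \<Rightarrow> (real \<Rightarrow> real) \<Rightarrow> (real ^ 'd \<Rightarrow> real)
      \<Rightarrow> (real \<Rightarrow> real) \<Rightarrow> (real \<Rightarrow> real) \<Rightarrow> bool" where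
  "local_attractor \<epsilon> \<omega> g f x v \<longleftrightarrow>
     (\<exists>\<delta>>0. \<forall>a b. \<bar>a - x 0\<bar> + \<bar>b - v 0\<bar> < \<delta> \<longrightarrow>
        (\<exists>y w. solves_on \<epsilon> \<omega> g f {0..} y w \<and> y 0 = a \<and> w 0 = b \<and>
           (\<forall>\<tau>>0. \<forall>z u. solves_on \<epsilon> \<omega> g f {0..<\<tau>} z u \<and> z 0 = a \<and> u 0 = b \<longrightarrow>
              (\<forall>t\<in>{0..<\<tau>}. z t = y t \<and> u t = w t)) \<and>
           ((\<lambda>t. \<bar>y t - x t\<bar> + \<bar>w t - v t\<bar>) \<longlongrightarrow> 0) at_top))"

end

theory Submission
  imports Defs
begin

text \<open>
  Write \<open>x = c0 + Y\<close> and \<open>a = g' c0\<close>. The linear part factors as \<open>(d/dt - l2) (d/dt - l1)\<close> with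
  \<open>l1 l2 = a\<close>, \<open>l1 + l2 = - 1 / \<epsilon>\<close> and \<open>\<bar>l2\<bar> \<ge> 1 / (2 \<bar>\<epsilon>\<bar>)\<close>. On continuous functions on the torus,
  \<open>d/dt - l\<close> along the flow of \<open>\<omega>\<close> has an inverse of norm at most \<open>1 / \<bar>l\<bar>\<close> for real \<open>l \<noteq> 0\<close>, so the
  inverse of the linear part has norm at most \<open>1 / \<bar>a\<bar>\<close>, uniformly in \<open>\<epsilon>\<close>, and the remainder
  \<open>g (c0 + Y) - g c0 - a Y\<close> is a contraction on a small ball. The forcing \<open>f - f0\<close> is uniformly close
  to the flow derivative of a trigonometric polynomial \<open>Q\<close> (as \<open>\<omega>\<close> is nonresonant), which the inverse
  maps to \<open>O(\<parallel>Q\<parallel> / \<bar>l2\<bar>) = O(\<epsilon>)\<close>. If \<open>a, \<epsilon> > 0\<close>, both roots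
  are negative and a second contraction, in an exponentially weighted norm on \<open>[0, \<infinity>)\<close>, gives the
  decay of perturbations.
\<close>

section \<open>Analytic and periodic functions\<close>

text \<open>The obstacle is the root \<open>l1\<close>, which tends to 0 like
  \<open>- a * \<epsilon>\<close>: its inverse alone is of size
  \<open>1 / \<bar>a * \<epsilon>\<bar>\<close>. Pairing it with the inverse for \<open>l2\<close>
  restores a uniform bound, but only a bound: an arbitrary forcing of size 1 would be answered by
  something of size \<open>1 / \<bar>a\<bar>\<close>, far outside the ball where \<open>g\<close> is
  nearly linear. Smallness therefore has to come from averaging. A forcing that is exactly a flow
  derivative of some \<open>Q\<close> is answered at the \<open>l1\<close> stage by at most twice
  the bound of \<open>Q\<close>, however small \<open>l1\<close> is, and the \<open>l2\<close> stage
  then contributes a factor of order \<epsilon>. The assumption \<open>g c0 = f0\<close> is what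
  removes the mean, which has no bounded primitive. Small divisors occur only in the coefficients of
  \<open>Q\<close>. Its bound is fixed before \<open>\<epsilon>0\<close> is chosen, so they affect
  the size of \<open>\<epsilon>0\<close> and nothing else. Inverting \<open>d/dt - l\<close> meets
  none, since for real \<open>l\<close> the symbol
  \<open>\<i> * (\<omega> \<bullet> \<nu>) - l\<close> has modulus at least
  \<open>\<bar>l\<bar>\<close>. This is why \<epsilon> is taken small enough for both roots to be
  real.\<close>

lemma real_analytic_C1:
  assumes "real_analytic g"
  shows "(g has_real_derivative deriv g x) (at x)" and "isCont (deriv g) x"
proof -
  obtain a r where r: "r > 0"
    and sums: "\<And>y. \<bar>y - x\<bar> < r \<Longrightarrow> (\<lambda>n. a n * (y - x) ^ n) sums g y"
    using assms unfolding real_analytic_def by meson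
  have summ: "summable (\<lambda>n. a n * h ^ n)" if "norm h < r" for h
    using sums[of "x + h"] that by (auto dest: sums_summable)
  define G' where "G' h = (\<Sum>n. diffs a n * h ^ n)" for h
  have der: "(g has_real_derivative G' (y - x)) (at y)" if y: "\<bar>y - x\<bar> < r" for y
  proof -
    have 1: "((\<lambda>h. \<Sum>n. a n * h ^ n) has_real_derivative G' (y - x)) (at (y - x))"
      unfolding G'_def by (rule termdiffs_strong'[of r]) (use summ y in auto)
    have 2: "((\<lambda>z. \<Sum>n. a n * (z - x) ^ n) has_real_derivative G' (y - x)) (at y)"
      using DERIV_shift[of "\<lambda>h. \<Sum>n. a n * h ^ n" "G' (y - x)" y "- x"] 1 by simp
    have "open {z. \<bar>z - x\<bar> < r}"
      by (intro open_Collect_less continuous_intros)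
    then show ?thesis
      by (rule has_field_derivative_transform_within_open[OF 2]) (use y sums in \<open>auto simp: sums_iff\<close>)
  qed
  have deriv: "deriv g y = G' (y - x)" if "\<bar>y - x\<bar> < r" for y
    using der[OF that] by (rule DERIV_imp_deriv)
  show "(g has_real_derivative deriv g x) (at x)"
    using der[of x] deriv[of x] r by simp
  \<comment> \<open>Continuity at the centre of the expansion suffices, because the centre
    \<open>x\<close> is an arbitrary point.\<close>
  have "isCont G' 0"
    unfolding G'_def
  proof (rule isCont_powser)
    show "summable (\<lambda>n. diffs a n * (r / 2) ^ n)"
      by (rule termdiff_converges[of _ r]) (use r summ in auto)
  qed (use r in auto)
  then have "isCont (\<lambda>y. G' (y - x)) x"
    by (intro isCont_o2[of _ "\<lambda>y. y - x" G']) (auto intro!: continuous_intros)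
  moreover have "\<forall>\<^sub>F y in nhds x. deriv g y = G' (y - x)"
    unfolding eventually_nhds_metric using deriv r by (auto simp: dist_real_def)
  ultimately show "isCont (deriv g) x"
    by (subst isCont_cong)
qed

text \<open>Absolute convergence at the corner \<open>c + (\<rho>, ..., \<rho>)\<close> yields a
  summable majorant \<open>b\<close>. At distance \<open>q * \<rho>\<close> from \<open>c\<close>
  with \<open>q < 1\<close>, every nonconstant term is at most \<open>q * b k\<close>, so
  \<open>f y - f c\<close> is at most \<open>q\<close> times the sum of \<open>b\<close>. This is a
  Lipschitz estimate at the centre.\<close>

lemma real_analytic_vec_continuous:
  fixes f :: "real ^ 'd \<Rightarrow> real"
  assumes "real_analytic_vec f"
  shows "continuous_on UNIV f"
proof -
  have "isCont f c" for c
  proof -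
    obtain a :: "nat ^ 'd \<Rightarrow> real" and r where r: "r > 0"
      and hs: "\<And>y. (\<And>i. \<bar>y $ i - c $ i\<bar> < r) \<Longrightarrow>
        ((\<lambda>k. a k * (\<Prod>i\<in>UNIV. (y $ i - c $ i) ^ (k $ i))) has_sum f y) UNIV"
      using assms unfolding real_analytic_vec_def by meson
    define \<rho> where "\<rho> = r / 2"
    have \<rho>: "\<rho> > 0" "\<rho> < r" using r by (auto simp: \<rho>_def)
    define b where "b k = \<bar>a k\<bar> * (\<Prod>i\<in>UNIV. \<rho> ^ (k $ i))" for k
    have "((\<lambda>k. a k * (\<Prod>i\<in>UNIV. \<rho> ^ (k $ i))) has_sum f (c + (\<chi> i. \<rho>))) UNIV"
      using hs[of "c + (\<chi> i. \<rho>)"] \<rho> by simp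
    then have "(\<lambda>k. norm (a k * (\<Prod>i\<in>UNIV. \<rho> ^ (k $ i)))) summable_on UNIV"
      by (rule iffD1[OF summable_on_iff_abs_summable_on_real has_sum_imp_summable])
    moreover have pnn: "(\<Prod>i\<in>UNIV. \<rho> ^ (k $ i)) \<ge> 0" for k :: "nat ^ 'd"
      using \<rho> by (intro prod_nonneg) auto
    ultimately have bs: "b summable_on UNIV"
      by (simp add: b_def[abs_def] abs_mult)
    define B where "B = infsum b UNIV"
    have bnn: "b k \<ge> 0" for k by (simp add: b_def pnn)
    have fc: "f c = a 0"
    proof -
      have *: "(\<Prod>i\<in>UNIV. (c $ i - c $ i) ^ (k $ i)) = (if k = 0 then 1 else (0::real))" for k :: "nat ^ 'd"
      proof (cases "k = 0")
        case False
        then obtain j where "k $ j \<noteq> 0" by (auto simp: vec_eq_iff)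
        then show ?thesis using False by (auto intro!: prod_zero bexI[of _ j])
      qed simp
      have "((\<lambda>k. a k * (\<Prod>i\<in>UNIV. (c $ i - c $ i) ^ (k $ i))) has_sum f c) UNIV"
        using r by (intro hs) auto
      then have "((\<lambda>k::nat^'d. if k = 0 then a 0 else 0) has_sum f c) UNIV"
        unfolding * by (simp add: if_distrib cong: if_cong)
      moreover have "((\<lambda>k::nat^'d. if k = 0 then a 0 else 0) has_sum a 0) UNIV"
        by (subst has_sum_cong_neutral[where T="{0}" and g="\<lambda>_. a 0"]) (auto simp: has_sum_finite_iff)
      ultimately show ?thesis by (rule has_sum_unique)
    qed
    have bound: "\<bar>f y - f c\<bar> \<le> 2 * B * (norm (y - c) / \<rho>)" if y: "norm (y - c) < \<rho>" for y
    proof -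
      define q where "q = norm (y - c) / \<rho>"
      have q: "0 \<le> q" "q < 1" using y \<rho> by (auto simp: q_def)
      have ci: "\<bar>y $ i - c $ i\<bar> \<le> \<rho> * q" for i
        using component_le_norm_cart[of "y - c" i] \<rho> by (simp add: q_def)
      have ci': "\<bar>y $ i - c $ i\<bar> < r" for i
        using component_le_norm_cart[of "y - c" i] \<rho> y by (simp)
      define t where "t k = a k * (\<Prod>i\<in>UNIV. (y $ i - c $ i) ^ (k $ i)) - (if k = 0 then a 0 else 0)" for k
      have 0: "((\<lambda>k::nat^'d. if k = 0 then a 0 else 0) has_sum a 0) UNIV"
        by (subst has_sum_cong_neutral[where T="{0}" and g="\<lambda>_. a 0"]) (auto simp: has_sum_finite_iff)
      have t: "(t has_sum (f y - f c)) UNIV"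
        unfolding t_def fc using has_sum_add[OF hs[OF ci'] has_sum_uminusI[OF 0]] by simp
      have tb: "\<bar>t k\<bar> \<le> q * b k" for k
      proof (cases "k = 0")
        case True then show ?thesis using bnn q by (simp add: t_def)
      next
        case False
        then obtain j where j: "k $ j \<noteq> 0" by (auto simp: vec_eq_iff)
        have "\<bar>t k\<bar> = \<bar>a k\<bar> * (\<Prod>i\<in>UNIV. \<bar>y $ i - c $ i\<bar> ^ (k $ i))"
          using False by (simp add: t_def abs_mult abs_prod power_abs)
        also have "\<dots> \<le> \<bar>a k\<bar> * (\<Prod>i\<in>UNIV. (\<rho> * q) ^ (k $ i))"
          by (intro mult_left_mono prod_mono conjI power_mono ci) auto
        also have "(\<Prod>i\<in>UNIV. (\<rho> * q) ^ (k $ i)) = (\<Prod>i\<in>UNIV. \<rho> ^ (k $ i)) * (\<Prod>i\<in>UNIV. q ^ (k $ i))"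
          by (simp add: power_mult_distrib prod.distrib)
        \<comment> \<open>A nonconstant monomial has some exponent \<open>k $ j \<ge> 1\<close>.
          That coordinate supplies the single factor \<open>q\<close>, and all other powers of
          \<open>q\<close> are bounded by 1.\<close>
        also have "(\<Prod>i\<in>UNIV. q ^ (k $ i)) = q ^ (k $ j) * (\<Prod>i\<in>UNIV - {j}. q ^ (k $ i))"
          by (subst prod.remove[of _ j]) auto
        also have "\<bar>a k\<bar> * ((\<Prod>i\<in>UNIV. \<rho> ^ (k $ i)) * (q ^ (k $ j) * (\<Prod>i\<in>UNIV - {j}. q ^ (k $ i))))
          \<le> \<bar>a k\<bar> * ((\<Prod>i\<in>UNIV. \<rho> ^ (k $ i)) * (q * 1))"
        proof (intro mult_left_mono mult_mono)
          show "q ^ (k $ j) \<le> q" using j q power_decreasing[of 1 "k $ j" q] by simp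
          show "(\<Prod>i\<in>UNIV - {j}. q ^ (k $ i)) \<le> 1"
            by (intro prod_le_1) (use q in \<open>auto intro: power_le_one\<close>)
        qed (use q \<rho> in \<open>auto intro!: prod_nonneg\<close>)
        finally show ?thesis by (simp add: b_def mult_ac)
      qed
      have ts: "(\<lambda>k. norm (t k)) summable_on UNIV"
        using t by (rule iffD1[OF summable_on_iff_abs_summable_on_real has_sum_imp_summable])
      have "norm (infsum t UNIV) \<le> infsum (\<lambda>k. norm (t k)) UNIV"
        using ts by (rule norm_infsum_bound)
      also have "\<dots> \<le> infsum (\<lambda>k. q * b k) UNIV"
        by (rule infsum_mono) (use ts bs tb in \<open>auto intro: summable_on_cmult_right\<close>)
      also have "\<dots> = q * B" by (simp add: infsum_cmult_right' B_def)
      finally have "\<bar>f y - f c\<bar> \<le> q * B" using infsumI[OF t] by simp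
      moreover have "B \<ge> 0" unfolding B_def by (rule infsum_nonneg) (use bnn in auto)
      ultimately have "\<bar>f y - f c\<bar> \<le> 2 * (q * B)" using q mult_nonneg_nonneg[of q B] by linarith
      then show ?thesis by (simp add: q_def mult_ac)
    qed
    have "(f \<longlongrightarrow> f c) (at c)"
    proof (rule LIM_zero_cancel, rule Lim_null_comparison)
      have "\<forall>\<^sub>F y in at c. dist y c < \<rho>"
        using \<rho> unfolding eventually_at by auto
      then show "\<forall>\<^sub>F y in at c. norm (f y - f c) \<le> 2 * B * (norm (y - c) / \<rho>)"
        by eventually_elim (use bound in \<open>auto simp: dist_norm\<close>)
      have "((\<lambda>y. 2 * B * (norm (y - c) / \<rho>)) \<longlongrightarrow> 2 * B * (norm (c - c) / \<rho>)) (at c)"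
        by (intro tendsto_intros) (use \<rho> in auto)
      then show "((\<lambda>y. 2 * B * (norm (y - c) / \<rho>)) \<longlongrightarrow> 0) (at c)" by simp
    qed
    then show ?thesis by (simp add: isCont_def)
  qed
  then show ?thesis by (simp add: continuous_on_eq_continuous_at)
qed

section \<open>Nonresonance and invariance under the period lattice\<close>

lemma bryuno_condition_nonresonant:
  assumes "bryuno_condition \<omega>" "\<nu> \<noteq> 0"
  shows "\<omega> \<bullet> real_vec \<nu> \<noteq> 0"
proof -
  obtain j where "\<nu> $ j \<noteq> 0" using assms(2) by (auto simp: vec_eq_iff)
  then have pos: "0 < l1_norm \<nu>"
    unfolding l1_norm_def by (intro sum_pos2[of _ j]) auto
  \<comment> \<open>Any level \<open>n\<close> with \<open>l1_norm \<nu> \<le> 2 ^ n\<close> puts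
    \<open>\<nu>\<close> among the competitors of the infimum; the norm itself is an explicit such
    level.\<close>
  have "int (nat (l1_norm \<nu>)) < 2 ^ nat (l1_norm \<nu>)"
    by (rule of_nat_less_two_power)
  then have "l1_norm \<nu> < 2 ^ nat (l1_norm \<nu>)"
    using pos by simp
  then have "bryuno_alpha \<omega> (nat (l1_norm \<nu>)) \<le> \<bar>\<omega> \<bullet> real_vec \<nu>\<bar>"
    unfolding bryuno_alpha_def by (intro cINF_lower bdd_belowI2[where m = 0]) (use pos in auto)
  moreover have "bryuno_alpha \<omega> (nat (l1_norm \<nu>)) > 0"
    using assms(1) by (simp add: bryuno_condition_def)
  ultimately show ?thesis by auto
qed

lemma torus_periodic_lattice:
  fixes f :: "real ^ 'd \<Rightarrow> 'b"
  assumes "torus_periodic f"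
  shows "f (\<psi> + (2 * pi) *\<^sub>R real_vec \<nu>) = f \<psi>"
proof -
  have nat: "f (\<psi> + axis i (2 * pi * real n)) = f \<psi>" for \<psi> i n
  proof (induction n)
    case (Suc n)
    have "\<psi> + axis i (2 * pi * real (Suc n)) = (\<psi> + axis i (2 * pi * real n)) + axis i (2 * pi)"
      by (auto simp: vec_eq_iff axis_def algebra_simps)
    then have "f (\<psi> + axis i (2 * pi * real (Suc n))) = f (\<psi> + axis i (2 * pi * real n))"
      using assms by (metis torus_periodic_def)
    then show ?case using Suc by simp
  qed (simp add: axis_def vec_eq_iff zero_vec_def[symmetric])
  have int: "f (\<psi> + axis i (2 * pi * real_of_int m)) = f \<psi>" for \<psi> i m
  proof (cases "m \<ge> 0")
    case True then show ?thesis using nat[of \<psi> i "nat m"] by simp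
  next
    case False
    have "(\<psi> + axis i (2 * pi * real_of_int m)) + axis i (2 * pi * real (nat (- m))) = \<psi>"
      using False by (auto simp: vec_eq_iff axis_def algebra_simps)
    then show ?thesis using nat[of "\<psi> + axis i (2 * pi * real_of_int m)" i "nat (- m)"] by metis
  qed
  have "f (\<psi> + (\<Sum>i\<in>I. axis i (2 * pi * real_of_int (\<nu> $ i)))) = f \<psi>" if "finite I" for I
    using that
  proof (induction I)
    case (insert i I)
    then show ?case
      using int[of "\<psi> + (\<Sum>i\<in>I. axis i (2 * pi * real_of_int (\<nu> $ i)))" i "\<nu> $ i"]
      by (simp add: algebra_simps)
  qed simp
  moreover have "(\<Sum>i\<in>UNIV. axis i (2 * pi * real_of_int (\<nu> $ i))) = (2 * pi) *\<^sub>R real_vec \<nu>"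
    by (simp add: vec_eq_iff real_vec_def axis_def)
  ultimately show ?thesis
    by (metis finite)
qed

section \<open>Bounded solutions of linear equations along the flow\<close>

text \<open>A relation rather than an operator: only differentiability along orbits is asked for,
  since the functions obtained below are merely continuous in directions transverse to
  \<open>\<omega>\<close>. Quantifying over the base point \<open>\<psi>\<close> turns an estimate
  at time 0 on each orbit into one on the whole space.\<close>

definition flow_deriv :: "'a::real_normed_vector \<Rightarrow> ('a \<Rightarrow> real) \<Rightarrow> ('a \<Rightarrow> real) \<Rightarrow> bool" where
  "flow_deriv \<omega> U D \<longleftrightarrow>
     (\<forall>\<psi> t. ((\<lambda>t. U (\<psi> + t *\<^sub>R \<omega>)) has_real_derivative D (\<psi> + t *\<^sub>R \<omega>)) (at t))"

lemma flow_deriv_add: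
  "flow_deriv \<omega> U D \<Longrightarrow> flow_deriv \<omega> V E \<Longrightarrow> flow_deriv \<omega> (\<lambda>\<psi>. U \<psi> + V \<psi>) (\<lambda>\<psi>. D \<psi> + E \<psi>)"
  unfolding flow_deriv_def by (auto intro: DERIV_add)

lemma flow_deriv_diff:
  "flow_deriv \<omega> U D \<Longrightarrow> flow_deriv \<omega> V E \<Longrightarrow> flow_deriv \<omega> (\<lambda>\<psi>. U \<psi> - V \<psi>) (\<lambda>\<psi>. D \<psi> - E \<psi>)"
  unfolding flow_deriv_def by (auto intro: DERIV_diff)

text \<open>The function \<open>exp (- l * t) * (u t + K / l)\<close> is nonincreasing because
  \<open>h \<le> K\<close>, and it tends to 0 at infinity because \<open>u\<close> is bounded. Hence
  it is nonnegative. The bound \<open>B\<close> serves only for this limit and leaves no trace in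
  the estimate.\<close>

lemma growing_ode_lower_bound:
  fixes u :: "real \<Rightarrow> real"
  assumes l: "l > 0" and bdd: "\<And>t. \<bar>u t\<bar> \<le> B"
    and u: "\<And>t. (u has_real_derivative l * u t + h t) (at t)"
    and h: "\<And>t. h t \<le> K"
  shows "- K / l \<le> u t"
proof -
  define w where "w t = exp (- l * t) * (u t + K / l)" for t
  have w: "(w has_real_derivative exp (- l * t) * (h t - K)) (at t)" for t
    unfolding w_def by (rule derivative_eq_intros u refl | simp)+ (use l in \<open>simp add: field_simps\<close>)
  have mono: "w s \<le> w t" if "t \<le> s" for s t
  proof (rule DERIV_nonpos_imp_nonincreasing[OF that])
    show "\<exists>y. (w has_real_derivative y) (at x) \<and> y \<le> 0" for x
      using w[of x] h[of x] by (auto intro!: exI mult_nonneg_nonpos)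
  qed
  have lim: "((\<lambda>s. exp (- l * s)) \<longlongrightarrow> 0) at_top"
    by (rule filterlim_compose[OF exp_at_bot filterlim_tendsto_neg_mult_at_bot[OF tendsto_const _ filterlim_ident]])
      (use l in simp)
  have "(w \<longlongrightarrow> 0) at_top"
  proof (rule Lim_null_comparison)
    have "\<bar>u s + K / l\<bar> \<le> B + \<bar>K / l\<bar>" for s
      using bdd[of s] by linarith
    then show "\<forall>\<^sub>F s in at_top. norm (w s) \<le> exp (- l * s) * (B + \<bar>K / l\<bar>)"
      by (simp add: w_def abs_mult)
    show "((\<lambda>s. exp (- l * s) * (B + \<bar>K / l\<bar>)) \<longlongrightarrow> 0) at_top"
      using tendsto_mult_left_zero[OF lim] by simp
  qed
  then have "0 \<le> w t"
    by (rule tendsto_upperbound) (use mono[of t] in \<open>auto simp: eventually_at_top_linorder\<close>)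
  then show ?thesis by (simp add: w_def zero_le_mult_iff)
qed

text \<open>The a priori bound \<open>B\<close> is absent from the conclusion, so this is both
  uniqueness of the bounded solution (take \<open>K = 0\<close>) and the norm estimate
  \<open>1 / \<bar>l\<bar>\<close> for the inverse of \<open>d/dt - l\<close>.\<close>

lemma bounded_linear_ode_bound:
  fixes u :: "real \<Rightarrow> real"
  assumes l: "l \<noteq> 0" and bdd: "\<And>t. \<bar>u t\<bar> \<le> B"
    and u: "\<And>t. (u has_real_derivative l * u t + h t) (at t)"
    and h: "\<And>t. \<bar>h t\<bar> \<le> K"
  shows "\<bar>u t\<bar> \<le> K / \<bar>l\<bar>"
proof -
  have growing: "\<bar>v t\<bar> \<le> K / m"
    if m: "m > 0" and vB: "\<And>t. \<bar>v t\<bar> \<le> B"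
      and v: "\<And>t. (v has_real_derivative m * v t + k t) (at t)" and k: "\<And>t. \<bar>k t\<bar> \<le> K"
    for v k :: "real \<Rightarrow> real" and m t
  proof -
    have "- K / m \<le> v t"
      by (rule growing_ode_lower_bound[OF m vB v]) (use k abs_le_D1 in blast)
    moreover have "((\<lambda>t. - v t) has_real_derivative m * - v t + - k t) (at t)" for t
      using DERIV_minus[OF v[of t]] by simp
    then have "- K / m \<le> - v t"
      by (rule growing_ode_lower_bound[OF m, rotated]) (use vB k abs_le_D2 in auto)
    ultimately show ?thesis by auto
  qed
  show ?thesis
  proof (cases "l > 0")
    case True
    then show ?thesis using growing[OF True bdd u h] by simp
  next
    case False
    \<comment> \<open>Time reversal exchanges decay and growth, which reduces negative
      \<open>l\<close> to the case just treated.\<close>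
    have "((\<lambda>t. u (- t)) has_real_derivative (- l) * u (- t) + (- h (- t))) (at t)" for t
      using DERIV_mirror[of u "l * u (- t) + h (- t)" t] u[of "- t"] by simp
    from growing[OF _ _ this, of "- t"] show ?thesis
      using l False bdd h by auto
  qed
qed

section \<open>Existence of the bounded solution on the torus\<close>

lemma exp_integrable_halfline:
  assumes "k > (0::real)"
  shows "integrable lborel (\<lambda>s. indicator {0..} s * exp (- k * s))"
proof -
  have "(\<lambda>s. exp (- k * s)) absolutely_integrable_on {0..}"
    by (rule nonnegative_absolutely_integrable_1[OF integrable_on_exp_minus_to_infinity[OF assms]]) simp
  then have "integrable lebesgue (\<lambda>s. indicator {0..} s * exp (- k * s))"
    by (simp add: set_integrable_def)
  then show ?thesis
    by (subst (asm) integrable_completion) auto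
qed

text \<open>The solution is the integral of the forcing over the past of the orbit, weighted by
  \<open>exp (- k * s)\<close>. Continuity on the torus follows by dominated convergence and
  periodicity is inherited from the integrand.\<close>

lemma resolvent_exists_damped:
  fixes H :: "real ^ 'd \<Rightarrow> real"
  assumes k: "k > 0" and H: "continuous_on UNIV H" "\<And>\<psi>. \<bar>H \<psi>\<bar> \<le> M" and per: "torus_periodic H"
  shows "\<exists>U B. continuous_on UNIV U \<and> torus_periodic U \<and> (\<forall>\<psi>. \<bar>U \<psi>\<bar> \<le> B) \<and>
           flow_deriv \<omega> U (\<lambda>\<psi>. - k * U \<psi> + H \<psi>)"
proof -
  define K where "K s = indicator {0..} s * exp (- k * s)" for s :: real
  define U where "U \<psi> = (\<integral>s. K s * H (\<psi> - s *\<^sub>R \<omega>) \<partial>lborel)" for \<psi>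
  have Kint: "integrable lborel K"
    unfolding K_def using k by (rule exp_integrable_halfline)
  have Kpos: "K s \<ge> 0" for s by (simp add: K_def)
  have [measurable]: "K \<in> borel_measurable borel" unfolding K_def by measurable
  have Hm: "(\<lambda>s. H (\<psi> - s *\<^sub>R \<omega>)) \<in> borel_measurable borel" for \<psi>
    by (intro borel_measurable_continuous_onI continuous_on_compose2[OF H(1)] continuous_intros) auto
  have KM: "integrable lborel (\<lambda>s. K s * M)" using Kint by simp
  have bnd: "norm (K s * H \<psi>) \<le> K s * M" for s \<psi>
    using Kpos H(2) by (auto simp: abs_mult intro!: mult_left_mono)
  have int: "integrable lborel (\<lambda>s. K s * H (\<psi> - s *\<^sub>R \<omega>))" for \<psi>
    by (rule Bochner_Integration.integrable_bound[OF KM])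
      (use Hm order_trans[OF bnd abs_ge_self] in auto)
  have cont: "continuous_on UNIV U"
    unfolding continuous_on_sequentially
  proof (intro ballI allI impI)
    fix x :: "nat \<Rightarrow> real ^ 'd" and a
    assume "(\<forall>n. x n \<in> UNIV) \<and> x \<longlonglongrightarrow> a"
    then have x: "x \<longlonglongrightarrow> a" by simp
    show "(U \<circ> x) \<longlonglongrightarrow> U a"
      unfolding U_def comp_def
    proof (rule integral_dominated_convergence[OF _ _ KM])
      show "AE s in lborel. (\<lambda>i. K s * H (x i - s *\<^sub>R \<omega>)) \<longlonglongrightarrow> K s * H (a - s *\<^sub>R \<omega>)"
      proof (rule AE_I2)
        fix s
        have "isCont H (a - s *\<^sub>R \<omega>)" using H(1) by (simp add: continuous_on_eq_continuous_at)
        then show "(\<lambda>i. K s * H (x i - s *\<^sub>R \<omega>)) \<longlonglongrightarrow> K s * H (a - s *\<^sub>R \<omega>)"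
          by (intro tendsto_mult tendsto_const isCont_tendsto_compose[of _ H] tendsto_diff x)
      qed
    qed (use Hm bnd in auto)
  qed
  have Uper: "torus_periodic U"
    unfolding torus_periodic_def U_def
  proof (intro allI arg_cong[where f = "integral\<^sup>L lborel"] ext)
    fix \<psi> i s
    show "K s * H (\<psi> + axis i (2 * pi) - s *\<^sub>R \<omega>) = K s * H (\<psi> - s *\<^sub>R \<omega>)"
      using per[unfolded torus_periodic_def, rule_format, of "\<psi> - s *\<^sub>R \<omega>" i]
      by (simp add: algebra_simps)
  qed
  have Ubd: "\<bar>U \<psi>\<bar> \<le> (\<integral>s. K s * M \<partial>lborel)" for \<psi>
    unfolding U_def real_norm_def[symmetric]
    by (rule order_trans[OF integral_norm_bound]) (intro integral_mono KM integrable_norm int bnd)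
  have "((\<lambda>t. U (\<psi> + t *\<^sub>R \<omega>)) has_real_derivative - k * U (\<psi> + t *\<^sub>R \<omega>) + H (\<psi> + t *\<^sub>R \<omega>)) (at t)" for \<psi> t
  proof -
    \<comment> \<open>The substitution \<open>r = t - s\<close> moves \<open>t\<close> out of the
      argument of \<open>H\<close>, which is only continuous, and into the integration limit, where
      the fundamental theorem of calculus applies.\<close>
    define h where "h r = exp (k * r) * H (\<psi> + r *\<^sub>R \<omega>)" for r
    have hc: "continuous_on S h" for S
      unfolding h_def
      by (intro continuous_intros continuous_on_compose2[OF H(1)]) auto
    have Ut: "U (\<psi> + t *\<^sub>R \<omega>) = exp (- k * t) * (\<integral>r. indicator {..t} r * h r \<partial>lborel)"
      and it: "integrable lborel (\<lambda>r. indicator {..t} r * h r)" for t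
    proof -
      have eq: "exp (- k * t) * (indicator {..t} r * h r) = K (t - r) * H ((\<psi> + t *\<^sub>R \<omega>) - (t - r) *\<^sub>R \<omega>)" for r
        by (auto simp: h_def K_def indicator_def algebra_simps simp flip: exp_add)
      have "integrable lborel (\<lambda>r. K (t - r) * H ((\<psi> + t *\<^sub>R \<omega>) - (t - r) *\<^sub>R \<omega>))"
        using lborel_integrable_real_affine[OF int[of "\<psi> + t *\<^sub>R \<omega>"], of "-1" t] by simp
      then have "integrable lborel (\<lambda>r. exp (k * t) * (exp (- k * t) * (indicator {..t} r * h r)))"
        unfolding eq by (rule integrable_mult_right)
      then show "integrable lborel (\<lambda>r. indicator {..t} r * h r)"
        by (simp add: mult.assoc[symmetric] flip: exp_add)
      have "U (\<psi> + t *\<^sub>R \<omega>) = (\<integral>r. K (t - r) * H ((\<psi> + t *\<^sub>R \<omega>) - (t - r) *\<^sub>R \<omega>) \<partial>lborel)"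
        unfolding U_def using lborel_integral_real_affine[of "-1" "\<lambda>s. K s * H (\<psi> + t *\<^sub>R \<omega> - s *\<^sub>R \<omega>)" t] by simp
      also have "\<dots> = (\<integral>r. exp (- k * t) * (indicator {..t} r * h r) \<partial>lborel)"
        unfolding eq ..
      finally show "U (\<psi> + t *\<^sub>R \<omega>) = exp (- k * t) * (\<integral>r. indicator {..t} r * h r \<partial>lborel)"
        by simp
    qed
    \<comment> \<open>Cutting off the tail before \<open>t - 1\<close> leaves an integral over a
      compact interval that varies with its endpoint, and \<open>t\<close> stays interior to the
      region where the split is valid.\<close>
    define C where "C = (\<integral>r. indicator {..t - 1} r * h r \<partial>lborel)"
    have split: "(\<integral>r. indicator {..s} r * h r \<partial>lborel) = C + integral {t - 1..s} h" if "s \<ge> t - 1" for s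
    proof -
      have si: "set_integrable lborel {t - 1..s} h"
        by (rule borel_integrable_atLeastAtMost') (rule hc)
      have "(\<integral>r. indicator {..s} r * h r \<partial>lborel) = (\<integral>r. indicator {..t - 1} r * h r + indicator {t - 1..s} r * h r \<partial>lborel)"
      proof (rule integral_cong_AE)
        have "AE r in lborel. r \<noteq> t - 1" by (rule AE_lborel_singleton)
        then show "AE r in lborel. indicator {..s} r * h r = indicator {..t - 1} r * h r + indicator {t - 1..s} r * h r"
          by eventually_elim (use that in \<open>auto simp: indicator_def\<close>)
      qed (use hc[of UNIV, THEN borel_measurable_continuous_onI] in auto)
      also have "\<dots> = C + (\<integral>r. indicator {t - 1..s} r * h r \<partial>lborel)"
        unfolding C_def using it si by (intro Bochner_Integration.integral_add) (auto simp: set_integrable_def)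
      also have "(\<integral>r. indicator {t - 1..s} r * h r \<partial>lborel) = integral {t - 1..s} h"
        using set_borel_integral_eq_integral(2)[OF si] by (simp add: set_lebesgue_integral_def)
      finally show ?thesis .
    qed
    have "((\<lambda>s. integral {t - 1..s} h) has_real_derivative h t) (at t within {t - 1..t + 1})"
      by (rule integral_has_real_derivative) (auto simp: hc)
    then have I: "((\<lambda>s. integral {t - 1..s} h) has_real_derivative h t) (at t)"
      by (simp add: at_within_Icc_at)
    have "((\<lambda>s. exp (- k * s) * (C + integral {t - 1..s} h)) has_real_derivative
            - k * (exp (- k * t) * (C + integral {t - 1..t} h)) + exp (- k * t) * h t) (at t)"
      by (rule derivative_eq_intros I refl | simp)+
    then have "((\<lambda>t. U (\<psi> + t *\<^sub>R \<omega>)) has_real_derivative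
            - k * (exp (- k * t) * (C + integral {t - 1..t} h)) + exp (- k * t) * h t) (at t)"
      by (rule has_field_derivative_transform_within_open[of _ _ _ "{t - 1<..}"]) (auto simp: Ut split)
    moreover have "exp (- k * t) * h t = H (\<psi> + t *\<^sub>R \<omega>)"
      by (simp add: h_def exp_minus)
    moreover have "U (\<psi> + t *\<^sub>R \<omega>) = exp (- k * t) * (C + integral {t - 1..t} h)"
      by (simp only: Ut split)
    ultimately show ?thesis
      by (simp only:)
  qed
  then show ?thesis
    using cont Uper Ubd unfolding flow_deriv_def by blast
qed

lemma resolvent_exists:
  fixes H :: "real ^ 'd \<Rightarrow> real"
  assumes l: "l \<noteq> 0" and H: "continuous_on UNIV H" "\<And>\<psi>. \<bar>H \<psi>\<bar> \<le> M" and per: "torus_periodic H"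
  shows "\<exists>U B. continuous_on UNIV U \<and> torus_periodic U \<and> (\<forall>\<psi>. \<bar>U \<psi>\<bar> \<le> B) \<and>
           flow_deriv \<omega> U (\<lambda>\<psi>. l * U \<psi> + H \<psi>)"
proof (cases "l < 0")
  case True
  then show ?thesis using resolvent_exists_damped[of "- l", OF _ H per] by simp
next
  case False
  then obtain U B where U: "continuous_on UNIV U" "torus_periodic U" "\<forall>\<psi>. \<bar>U \<psi>\<bar> \<le> B"
    \<comment> \<open>For \<open>l > 0\<close> the orbit is integrated over its future, that is,
      over its past under the flow of \<open>- \<omega>\<close>. Reversing time gives
      \<open>U' = l U - H\<close> along \<open>\<omega>\<close>, so the witness is
      \<open>- U\<close>.\<close>
    and d: "flow_deriv (- \<omega>) U (\<lambda>\<psi>. - l * U \<psi> + H \<psi>)"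
    using resolvent_exists_damped[of l H M "- \<omega>"] l H per by auto
  have "((\<lambda>t. - U (\<psi> + t *\<^sub>R \<omega>)) has_real_derivative l * - U (\<psi> + t *\<^sub>R \<omega>) + H (\<psi> + t *\<^sub>R \<omega>)) (at t)" for \<psi> t
  proof -
    have "((\<lambda>t. U (\<psi> + t *\<^sub>R - \<omega>)) has_real_derivative - l * U (\<psi> + (- t) *\<^sub>R - \<omega>) + H (\<psi> + (- t) *\<^sub>R - \<omega>)) (at (- t))"
      using d unfolding flow_deriv_def by blast
    then show ?thesis
      using DERIV_minus[OF DERIV_mirror[THEN iffD1]] by fastforce
  qed
  then show ?thesis using U
    by (intro exI[of _ "\<lambda>\<psi>. - U \<psi>"] exI[of _ B])
      (auto simp: flow_deriv_def torus_periodic_def intro: continuous_on_minus)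
qed

section \<open>Approximation by flow derivatives\<close>

text \<open>The phase \<open>\<theta>\<close> makes sines special cases of cosines, so closure under
  products needs only the formula for a product of two cosines. Integer frequencies make every such
  function periodic.\<close>

inductive trig_poly :: "(real ^ 'd \<Rightarrow> real) \<Rightarrow> bool" where
  wave: "trig_poly (\<lambda>\<psi>. c * cos (real_vec \<nu> \<bullet> \<psi> + \<theta>))"
| add: "trig_poly p \<Longrightarrow> trig_poly q \<Longrightarrow> trig_poly (\<lambda>\<psi>. p \<psi> + q \<psi>)"

lemma trig_poly_const: "trig_poly (\<lambda>_ :: real ^ 'd. c)"
proof -
  have "real_vec (0 :: int ^ 'd) = 0" by (simp add: real_vec_def vec_eq_iff)
  then show ?thesis using trig_poly.wave[of c "0 :: int ^ 'd" 0] by simp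
qed

lemma trig_poly_mult:
  assumes "trig_poly p" "trig_poly q"
  shows "trig_poly (\<lambda>\<psi>. p \<psi> * q \<psi>)"
  using assms(1)
proof induction
  case (wave c \<nu> \<theta>)
  from assms(2) show ?case
  proof induction
    case (wave c' \<nu>' \<theta>')
    have lin: "real_vec (\<nu> - \<nu>') = real_vec \<nu> - real_vec \<nu>'" "real_vec (\<nu> + \<nu>') = real_vec \<nu> + real_vec \<nu>'"
      by (simp_all add: real_vec_def vec_eq_iff)
    have "c * cos (real_vec \<nu> \<bullet> \<psi> + \<theta>) * (c' * cos (real_vec \<nu>' \<bullet> \<psi> + \<theta>')) =
       (c * c' / 2) * cos (real_vec (\<nu> - \<nu>') \<bullet> \<psi> + (\<theta> - \<theta>')) +
       (c * c' / 2) * cos (real_vec (\<nu> + \<nu>') \<bullet> \<psi> + (\<theta> + \<theta>'))" for \<psi>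
    proof -
      have 1: "real_vec (\<nu> - \<nu>') \<bullet> \<psi> + (\<theta> - \<theta>') = (real_vec \<nu> \<bullet> \<psi> + \<theta>) - (real_vec \<nu>' \<bullet> \<psi> + \<theta>')"
        and 2: "real_vec (\<nu> + \<nu>') \<bullet> \<psi> + (\<theta> + \<theta>') = (real_vec \<nu> \<bullet> \<psi> + \<theta>) + (real_vec \<nu>' \<bullet> \<psi> + \<theta>')"
        by (simp_all add: lin inner_diff_left inner_add_left)
      show ?thesis
        unfolding 1 2 cos_diff cos_add by (simp add: algebra_simps)
    qed
    then show ?case
      by (simp only:) (intro trig_poly.intros)
  next
    case (add p' q')
    from trig_poly.add[OF add.IH] show ?case
      by (simp add: distrib_left)
  qed
next
  case (add p q)
  from trig_poly.add[OF add.IH] show ?case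
    by (simp add: distrib_right)
qed

lemma trig_poly_sum:
  "finite A \<Longrightarrow> (\<And>i. i \<in> A \<Longrightarrow> trig_poly (p i)) \<Longrightarrow> trig_poly (\<lambda>\<psi>. \<Sum>i\<in>A. p i \<psi>)"
proof (induction A rule: finite_induct)
  case empty
  show ?case by (simp add: trig_poly_const)
next
  case (insert i A)
  then have "trig_poly (\<lambda>\<psi>. p i \<psi> + (\<Sum>i\<in>A. p i \<psi>))"
    by (intro trig_poly.add) simp_all
  then show ?case using insert.hyps by simp
qed

text \<open>The embedding of the torus as a compact subset of complex space. Periodic functions
  become functions on its image and coordinate polynomials become trigonometric ones, which brings
  Stone-Weierstrass into reach.\<close>

definition torus_point :: "real ^ 'd \<Rightarrow> complex ^ 'd" where
  "torus_point \<psi> = (\<chi> i. cis (\<psi> $ i))"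

lemma continuous_on_torus_point: "continuous_on S torus_point"
  unfolding torus_point_def by (intro continuous_intros)

lemma real_polynomial_torus_trig:
  fixes p :: "complex ^ 'd \<Rightarrow> real"
  assumes "real_polynomial_function p"
  shows "trig_poly (\<lambda>\<psi>. p (torus_point \<psi>))"
  using assms
proof induction
  case (linear L)
  have coord: "trig_poly (\<lambda>\<psi>. (torus_point \<psi> \<bullet> b) * L b)" if b: "b \<in> Basis" for b :: "complex ^ 'd"
  proof -
    obtain i u where b: "b = axis i u" and u: "u \<in> {1, \<i>}"
      using b by (auto simp: Basis_vec_def Basis_complex_def)
    \<comment> \<open>The real coordinate functionals are the real and imaginary parts of each
      \<open>cis\<close>; the phase turns the sine into a cosine.\<close>
    define \<theta> where "\<theta> = (if u = 1 then 0 else - pi / 2)"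
    have "(torus_point \<psi> \<bullet> b) * L b = L b * cos (real_vec (axis i 1) \<bullet> \<psi> + \<theta>)" for \<psi>
    proof -
      have *: "real_vec (axis i 1) = axis i 1"
        by (simp add: real_vec_def axis_def vec_eq_iff)
      have 1: "torus_point \<psi> \<bullet> b = cis (\<psi> $ i) \<bullet> u"
        by (simp add: b torus_point_def inner_axis)
      have 2: "real_vec (axis i 1) \<bullet> \<psi> = \<psi> $ i"
        unfolding * by (subst inner_commute) (simp add: inner_axis)
      have 3: "cis (\<psi> $ i) \<bullet> u = cos (\<psi> $ i + \<theta>)"
        using u by (auto simp: \<theta>_def inner_complex_def cos_diff)
      show ?thesis unfolding 1 2 3 by simp
    qed
    then show ?thesis by (simp only:) (rule trig_poly.wave)
  qed
  interpret L: bounded_linear L by fact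
  have sum_L: "(\<Sum>b\<in>Basis. (z \<bullet> b) * L b) = L z" for z
    by (subst (2) euclidean_representation[symmetric, of z]) (simp only: L.sum L.scaleR real_scaleR_def)
  have "trig_poly (\<lambda>\<psi>. \<Sum>b\<in>Basis. (torus_point \<psi> \<bullet> b) * L b)"
    by (intro trig_poly_sum coord finite_Basis)
  then show ?case
    unfolding sum_L .
next
  case (const c)
  show ?case by (rule trig_poly_const)
next
  case (add p q)
  from add.IH show ?case by (rule trig_poly.add)
next
  case (mult p q)
  from mult.IH show ?case by (rule trig_poly_mult)
qed

lemma torus_periodic_torus_point_eq:
  assumes "torus_periodic f" "torus_point \<psi> = torus_point \<phi>"
  shows "f \<psi> = f \<phi>"
proof -
  have "\<exists>n. \<psi> $ i = \<phi> $ i + 2 * pi * of_int n" for i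
  proof -
    have "cis (\<psi> $ i) = cis (\<phi> $ i)"
      using assms(2) by (simp add: torus_point_def vec_eq_iff)
    then have "sin (\<psi> $ i) = sin (\<phi> $ i) \<and> cos (\<psi> $ i) = cos (\<phi> $ i)"
      by (simp add: complex_eq_iff)
    then show ?thesis by (subst (asm) sin_cos_eq_iff) auto
  qed
  then obtain n where "\<And>i. \<psi> $ i = \<phi> $ i + 2 * pi * of_int (n i)" by metis
  then have "\<psi> = \<phi> + (2 * pi) *\<^sub>R real_vec (\<chi> i. n i)"
    by (simp add: vec_eq_iff real_vec_def)
  then show ?thesis using torus_periodic_lattice[OF assms(1)] by simp
qed

lemma trig_poly_dense:
  fixes f :: "real ^ 'd \<Rightarrow> real"
  assumes f: "continuous_on UNIV f" "torus_periodic f" and e: "e > 0"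
  shows "\<exists>p. trig_poly p \<and> (\<forall>\<psi>. \<bar>f \<psi> - p \<psi>\<bar> < e)"
proof -
  define S where "S = range (torus_point :: real ^ 'd \<Rightarrow> _)"
  define F where "F z = f (\<chi> i. Arg (z $ i))" for z :: "complex ^ 'd"
  have norm1: "norm (z $ i) = 1" if "z \<in> S" for z i
    using that by (auto simp: S_def torus_point_def)
  \<comment> \<open>\<open>Arg\<close> jumps across the negative real axis, so continuity of
    \<open>F\<close> is not visible from its definition. Measuring angles relative to a base point
    \<open>\<psi>\<close> changes them by lattice vectors only, and near the base point the
    quotients are close to 1, where \<open>Arg\<close> is continuous.\<close>
  have Farg: "F z = f (\<psi> + (\<chi> i. Arg (z $ i / torus_point \<psi> $ i)))" if z: "z \<in> S" for z \<psi>
    unfolding F_def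
  proof (rule torus_periodic_torus_point_eq[OF f(2)])
    have "cis (Arg (z $ i)) = z $ i" for i
      using norm1[OF z, of i] by (subst cis_Arg) (auto simp: sgn_div_norm)
    moreover have "cis (\<psi> $ i) * cis (Arg (z $ i / cis (\<psi> $ i))) = z $ i" for i
      using norm1[OF z, of i] by (subst cis_Arg) (auto simp: sgn_div_norm norm_divide)
    ultimately show "torus_point (\<chi> i. Arg (z $ i)) = torus_point (\<psi> + (\<chi> i. Arg (z $ i / torus_point \<psi> $ i)))"
      by (simp add: torus_point_def vec_eq_iff flip: cis_mult)
  qed
  have Fcont: "continuous_on S F"
    unfolding continuous_on_def
  proof
    fix z0 assume "z0 \<in> S"
    then obtain \<psi> where z0: "z0 = torus_point \<psi>" by (auto simp: S_def)
    have one: "z0 $ i / torus_point \<psi> $ i = 1" for i by (simp add: z0 torus_point_def)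
    have ne: "torus_point \<psi> $ i \<noteq> 0" for i by (simp add: torus_point_def)
    have argc: "isCont Arg (z0 $ i / torus_point \<psi> $ i)" for i
      unfolding one by (rule continuous_at_Arg) auto
    have "((\<lambda>z. \<psi> + (\<chi> i. Arg (z $ i / torus_point \<psi> $ i))) \<longlongrightarrow> \<psi> + (\<chi> i. Arg (z0 $ i / torus_point \<psi> $ i))) (at z0 within S)"
      by (intro tendsto_intros isCont_tendsto_compose[OF argc] ne)
    moreover have "isCont f (\<psi> + (\<chi> i. Arg (z0 $ i / torus_point \<psi> $ i)))"
      using f(1) by (simp add: continuous_on_eq_continuous_at)
    ultimately have "((\<lambda>z. f (\<psi> + (\<chi> i. Arg (z $ i / torus_point \<psi> $ i)))) \<longlongrightarrow> f (\<psi> + (\<chi> i. Arg (z0 $ i / torus_point \<psi> $ i)))) (at z0 within S)"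
      using isCont_tendsto_compose by blast
    moreover have "(F \<longlongrightarrow> l) (at z0 within S) \<longleftrightarrow>
        ((\<lambda>z. f (\<psi> + (\<chi> i. Arg (z $ i / torus_point \<psi> $ i)))) \<longlongrightarrow> l) (at z0 within S)" for l
      by (rule Lim_cong_within) (auto intro: Farg)
    ultimately show "(F \<longlongrightarrow> F z0) (at z0 within S)"
      unfolding Farg[OF \<open>z0 \<in> S\<close>, of \<psi>] by blast
  qed
  have "S = torus_point ` cbox (\<chi> i. - pi) (\<chi> i. pi)"
  proof -
    have "torus_point \<psi> \<in> torus_point ` cbox (\<chi> i. - pi) (\<chi> i. pi)" for \<psi> :: "real ^ 'd"
    proof (rule image_eqI)
      show "torus_point \<psi> = torus_point (\<chi> i. Arg (cis (\<psi> $ i)))"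
        by (simp add: torus_point_def cis_Arg sgn_div_norm)
      show "(\<chi> i. Arg (cis (\<psi> $ i))) \<in> cbox (\<chi> i. - pi) (\<chi> i. pi)"
        using Arg_bounded by (auto simp: mem_box_cart less_imp_le)
    qed
    then show ?thesis by (auto simp: S_def)
  qed
  then have "compact S"
    by (simp add: compact_continuous_image continuous_on_torus_point)
  then obtain q where q: "real_polynomial_function q" "\<And>z. z \<in> S \<Longrightarrow> \<bar>F z - q z\<bar> < e"
    using Stone_Weierstrass_real_polynomial_function[OF _ Fcont e] by blast
  have "F (torus_point \<psi>) = f \<psi>" for \<psi>
    using Farg[of "torus_point \<psi>" \<psi>] by (simp add: S_def torus_point_def zero_vec_def[symmetric])
  then show ?thesis
    using q real_polynomial_torus_trig[OF q(1)]
    by (intro exI[of _ "\<lambda>\<psi>. q (torus_point \<psi>)"]) (metis S_def rangeI)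
qed

section \<open>Averages over the torus and small divisors\<close>

lemma exp_period_integral:
  assumes "n \<noteq> (0::int)"
  shows "(\<integral>s. indicator {0..2 * pi} s *\<^sub>R exp (\<i> * of_real (of_int n * s)) \<partial>lborel) = 0"
proof -
  define c where "c = \<i> * complex_of_int n"
  have c: "c \<noteq> 0" using assms by (simp add: c_def)
  have eq: "exp (\<i> * of_real (of_int n * s)) = exp (c * of_real s)" for s
    by (simp add: c_def mult.assoc)
  have cont: "continuous_on {0..2 * pi} (\<lambda>s. exp (c * complex_of_real s))"
    by (intro continuous_intros)
  have "((\<lambda>s. exp (c * complex_of_real s)) has_integral
     exp (c * of_real (2 * pi)) / c - exp (c * of_real 0) / c) {0..2 * pi}"
  proof (rule fundamental_theorem_of_calculus)
    fix s
    have "((\<lambda>z. exp (c * z) / c) has_field_derivative exp (c * complex_of_real s)) (at (complex_of_real s))"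
      using DERIV_cdivide[OF DERIV_chain2[OF DERIV_exp DERIV_cmult_Id[of c]], of c] c by simp
    then show "((\<lambda>s. exp (c * of_real s) / c) has_vector_derivative exp (c * of_real s)) (at s within {0..2 * pi})"
      by (rule has_vector_derivative_real_field)
  qed simp
  moreover have "exp (c * of_real (2 * pi)) = 1"
    unfolding eq[symmetric] by (subst exp_eq_1) (auto intro!: exI[of _ n])
  ultimately have "integral {0..2 * pi} (\<lambda>s. exp (c * complex_of_real s)) = 0"
    by (simp add: integral_unique)
  then show ?thesis
    unfolding eq using set_borel_integral_eq_integral(2)[OF borel_integrable_atLeastAtMost'[OF cont]]
    by (simp add: set_lebesgue_integral_def)
qed

text \<open>The exponential factors over the coordinates, so by Fubini its integral is a product of
  one-dimensional integrals; one with \<open>\<nu> $ j \<noteq> 0\<close> vanishes over a full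
  period. Multiplying by \<open>c * exp (\<i> * \<theta>)\<close> and taking real parts restores
  amplitude and phase.\<close>

lemma wave_integral:
  fixes \<nu> :: "int ^ 'd"
  assumes "\<nu> \<noteq> 0"
  shows "((\<lambda>\<psi>. c * cos (real_vec \<nu> \<bullet> \<psi> + \<theta>)) has_integral 0) (cbox 0 (\<chi> i. 2 * pi))"
proof -
  interpret product_sigma_finite "\<lambda>_::real ^ 'd. lborel :: real measure"
    by standard
  define E where "E \<psi> = exp (\<i> * complex_of_real (real_vec \<nu> \<bullet> \<psi>))" for \<psi>
  define e where "e b s = indicator {0..2 * pi} s *\<^sub>R exp (\<i> * of_real ((real_vec \<nu> \<bullet> b) * s))" for b :: "real ^ 'd" and s
  have B: "\<exists>i. b = axis i 1" if "b \<in> Basis" for b :: "real ^ 'd"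
    using that by (auto simp: Basis_vec_def)
  have eint: "integrable lborel (e b)" for b
    unfolding e_def using borel_integrable_atLeastAtMost'[of 0 "2 * pi" "\<lambda>s. exp (\<i> * of_real ((real_vec \<nu> \<bullet> b) * s))"]
    by (simp add: set_integrable_def continuous_intros)
  have cE: "continuous_on S E" for S unfolding E_def by (intro continuous_intros)
  define C where "C = cbox 0 (\<chi> i. 2 * pi :: real ^ 'd)"
  have split: "indicator C (\<Sum>b\<in>Basis. y b *\<^sub>R b) *\<^sub>R E (\<Sum>b\<in>Basis. y b *\<^sub>R b) = (\<Prod>b\<in>Basis. e b (y b))" for y
  proof -
    have yb: "(\<Sum>b\<in>Basis. y b *\<^sub>R b) \<bullet> b = y b" if "b \<in> Basis" for b :: "real ^ 'd"
      using that by simp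
    have "indicator C (\<Sum>b\<in>Basis. y b *\<^sub>R b) = (\<Prod>b\<in>(Basis :: (real ^ 'd) set). indicator {0..2 * pi} (y b) :: real)"
    proof -
      have "(\<chi> i. 2 * pi) \<bullet> b = 2 * pi" if "b \<in> Basis" for b :: "real ^ 'd"
        using B[OF that] by (auto simp: inner_axis)
      then have mem: "(\<Sum>b\<in>Basis. y b *\<^sub>R b) \<in> C \<longleftrightarrow> (\<forall>b\<in>(Basis :: (real ^ 'd) set). y b \<in> {0..2 * pi})"
        unfolding C_def mem_box by (auto simp: yb)
      show ?thesis
      proof (cases "\<forall>b\<in>(Basis :: (real ^ 'd) set). y b \<in> {0..2 * pi}")
        case True
        then show ?thesis using mem by simp
      next
        case False
        then obtain b where "b \<in> (Basis :: (real ^ 'd) set)" "y b \<notin> {0..2 * pi}" by blast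
        then have "(\<Prod>b\<in>(Basis :: (real ^ 'd) set). indicator {0..2 * pi} (y b) :: real) = 0"
          by (intro prod_zero bexI[of _ b]) auto
        then show ?thesis using False mem by simp
      qed
    qed
    moreover have "E (\<Sum>b\<in>Basis. y b *\<^sub>R b) = (\<Prod>b\<in>Basis. exp (\<i> * of_real ((real_vec \<nu> \<bullet> b) * y b)))"
      by (simp add: E_def inner_sum_right sum_distrib_left exp_sum mult_ac)
    ultimately show ?thesis
      by (simp add: e_def prod.distrib scaleR_conv_of_real)
  qed
  have "(\<integral>\<psi>. indicator C \<psi> *\<^sub>R E \<psi> \<partial>lborel) = (\<integral>y. indicator C (\<Sum>b\<in>Basis. y b *\<^sub>R b) *\<^sub>R E (\<Sum>b\<in>Basis. y b *\<^sub>R b) \<partial>(\<Pi>\<^sub>M b\<in>(Basis::(real^'d) set). lborel))"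
    by (subst lborel_eq, subst integral_distr) (auto simp: C_def E_def)
  also have "\<dots> = (\<Prod>b\<in>Basis. \<integral>s. e b s \<partial>lborel)"
    unfolding split by (rule product_integral_prod) (auto simp: eint)
  also have "\<dots> = 0"
  proof -
    obtain j where j: "\<nu> $ j \<noteq> 0" using assms by (auto simp: vec_eq_iff)
    have "(\<integral>s. e (axis j 1) s \<partial>lborel) = 0"
      using exp_period_integral[OF j] by (simp add: e_def inner_axis real_vec_def)
    moreover have "axis j 1 \<in> (Basis :: (real ^ 'd) set)"
      by (auto simp: Basis_vec_def)
    ultimately show ?thesis by (intro prod_zero) auto
  qed
  finally have "(LINT \<psi>:C|lborel. E \<psi>) = 0" by (simp add: set_lebesgue_integral_def)
  moreover have "set_integrable lborel C E"
    unfolding C_def set_integrable_def by (intro borel_integrable_compact) (auto simp: cE)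
  ultimately have "(E has_integral 0) C"
    using set_borel_integral_eq_integral[of C E] by (metis integrable_integral)
  then have "((\<lambda>\<psi>. of_real c * exp (\<i> * of_real \<theta>) * E \<psi>) has_integral 0) C"
    using has_integral_mult_right[of E 0 C] by simp
  then have "((Re \<circ> (\<lambda>\<psi>. of_real c * exp (\<i> * of_real \<theta>) * E \<psi>)) has_integral Re 0) C"
    by (rule has_integral_linear) (rule bounded_linear_Re)
  moreover have "Re (of_real c * exp (\<i> * of_real \<theta>) * E \<psi>) = c * cos (real_vec \<nu> \<bullet> \<psi> + \<theta>)" for \<psi>
  proof -
    have "of_real c * exp (\<i> * of_real \<theta>) * E \<psi> = of_real c * cis (real_vec \<nu> \<bullet> \<psi> + \<theta>)"
      by (simp add: E_def cis_conv_exp distrib_left exp_add mult_ac)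
    also have "Re \<dots> = c * cos (real_vec \<nu> \<bullet> \<psi> + \<theta>)"
      by simp
    finally show ?thesis .
  qed
  ultimately show ?thesis by (simp add: C_def comp_def)
qed

lemma torus_cube_volume:
  "measure lborel (cbox 0 (\<chi> i. 2 * pi) :: (real ^ 'd) set) = (2 * pi) ^ CARD('d)"
proof -
  have "(0 :: real ^ 'd) \<in> cbox 0 (\<chi> i. 2 * pi)" by (simp add: mem_box_cart)
  then have "cbox 0 (\<chi> i. 2 * pi) \<noteq> ({} :: (real ^ 'd) set)" by blast
  then show ?thesis by (subst content_cbox_cart) auto
qed

text \<open>Termwise integration: the constant wave has no bounded primitive and goes into the mean
  \<open>m\<close>, while any other wave is divided by
  \<open>\<omega> \<bullet> real_vec \<nu>\<close>. The sum being finite, these divisors only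
  enlarge \<open>M\<close>. The mean is recorded as an integral so that it can be compared with that
  of another function.\<close>

lemma trig_poly_flow_primitive:
  fixes p :: "real ^ 'd \<Rightarrow> real"
  assumes "trig_poly p" and nonres: "\<And>\<nu>. \<nu> \<noteq> 0 \<Longrightarrow> \<omega> \<bullet> real_vec \<nu> \<noteq> 0"
  shows "\<exists>m Q M. (p has_integral m * (2 * pi) ^ CARD('d)) (cbox 0 (\<chi> i. 2 * pi)) \<and>
           (\<forall>\<psi>. \<bar>Q \<psi>\<bar> \<le> M) \<and> flow_deriv \<omega> Q (\<lambda>\<psi>. p \<psi> - m)"
  using assms(1)
proof induction
  case (wave c \<nu> \<theta>)
  show ?case
  proof (cases "\<nu> = 0")
    case True
    have "((\<lambda>_. c * cos \<theta>) has_integral (c * cos \<theta>) * (2 * pi) ^ CARD('d)) (cbox 0 (\<chi> i. 2 * pi) :: (real ^ 'd) set)"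
      using has_integral_const[of "c * cos \<theta>" "0 :: real ^ 'd" "\<chi> i. 2 * pi"]
      unfolding torus_cube_volume by (simp only: real_scaleR_def mult.commute)
    then show ?thesis using True
      by (intro exI[of _ "c * cos \<theta>"] exI[of _ "\<lambda>_. 0"] exI[of _ 0])
        (simp add: flow_deriv_def real_vec_def zero_vec_def[symmetric])
  next
    case False
    define s where "s = \<omega> \<bullet> real_vec \<nu>"
    have s: "s \<noteq> 0" using nonres[OF False] by (simp add: s_def)
    have "((\<lambda>t. c / s * sin (real_vec \<nu> \<bullet> (\<psi> + t *\<^sub>R \<omega>) + \<theta>)) has_real_derivative c * cos (real_vec \<nu> \<bullet> (\<psi> + t *\<^sub>R \<omega>) + \<theta>)) (at t)" for \<psi> t
    proof -
      have eq: "real_vec \<nu> \<bullet> (\<psi> + t *\<^sub>R \<omega>) + \<theta> = t * s + (real_vec \<nu> \<bullet> \<psi> + \<theta>)" for t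
        by (simp add: s_def inner_add_right inner_commute)
      show ?thesis unfolding eq
        by (rule derivative_eq_intros refl | simp)+ (use s in simp)
    qed
    moreover have "\<bar>c / s * sin (real_vec \<nu> \<bullet> \<psi> + \<theta>)\<bar> \<le> \<bar>c / s\<bar>" for \<psi>
      by (simp add: abs_mult divide_right_mono mult_left_le)
    ultimately show ?thesis using wave_integral[OF False, of c \<theta>]
      by (intro exI[of _ 0] exI[of _ "\<lambda>\<psi>. c / s * sin (real_vec \<nu> \<bullet> \<psi> + \<theta>)"] exI[of _ "\<bar>c / s\<bar>"])
        (simp add: flow_deriv_def)
  qed
next
  case (add p q)
  from add.IH obtain m Q M m' Q' M' where
    p: "(p has_integral m * (2 * pi) ^ CARD('d)) (cbox 0 (\<chi> i. 2 * pi))" "\<And>\<psi>. \<bar>Q \<psi>\<bar> \<le> M" "flow_deriv \<omega> Q (\<lambda>\<psi>. p \<psi> - m)"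
    and q: "(q has_integral m' * (2 * pi) ^ CARD('d)) (cbox 0 (\<chi> i. 2 * pi))" "\<And>\<psi>. \<bar>Q' \<psi>\<bar> \<le> M'" "flow_deriv \<omega> Q' (\<lambda>\<psi>. q \<psi> - m')"
    by blast
  have "((\<lambda>\<psi>. p \<psi> + q \<psi>) has_integral (m + m') * (2 * pi) ^ CARD('d)) (cbox 0 (\<chi> i. 2 * pi))"
    unfolding distrib_right using p(1) q(1) by (rule has_integral_add)
  moreover have "\<bar>Q \<psi> + Q' \<psi>\<bar> \<le> M + M'" for \<psi>
    using p(2)[of \<psi>] q(2)[of \<psi>] by linarith
  moreover have "flow_deriv \<omega> (\<lambda>\<psi>. Q \<psi> + Q' \<psi>) (\<lambda>\<psi>. p \<psi> + q \<psi> - (m + m'))"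
    using flow_deriv_add[OF p(3) q(3)] by (simp add: algebra_simps)
  ultimately show ?case
    by (intro exI[of _ "m + m'"] exI[of _ "\<lambda>\<psi>. Q \<psi> + Q' \<psi>"] exI[of _ "M + M'"]) simp
qed

text \<open>Subtracting from the polynomial \<open>p\<close> its own mean \<open>c\<close> is what
  makes it a flow derivative, while the claim concerns \<open>m\<close>. A uniform error of
  \<open>e / 2\<close> moves the average by at most \<open>e / 2\<close>, so both errors together
  stay within \<open>e\<close>.\<close>

lemma approx_flow_derivative:
  fixes f :: "real ^ 'd \<Rightarrow> real"
  assumes f: "continuous_on UNIV f" "torus_periodic f" and e: "e > 0"
    and nonres: "\<And>\<nu>. \<nu> \<noteq> 0 \<Longrightarrow> \<omega> \<bullet> real_vec \<nu> \<noteq> 0"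
    and mean: "complex_of_real m = fourier_coeff f 0"
  shows "\<exists>Q M D. (\<forall>\<psi>. \<bar>Q \<psi>\<bar> \<le> M) \<and> flow_deriv \<omega> Q D \<and> (\<forall>\<psi>. \<bar>f \<psi> - m - D \<psi>\<bar> \<le> e)"
proof -
  define C where "C = (cbox 0 (\<chi> i. 2 * pi) :: (real ^ 'd) set)"
  have vol: "measure lborel C = (2 * pi) ^ CARD('d)"
    unfolding C_def by (rule torus_cube_volume)
  obtain p where p: "trig_poly p" "\<And>\<psi>. \<bar>f \<psi> - p \<psi>\<bar> < e / 2"
    using trig_poly_dense[OF f, of "e / 2"] e by auto
  obtain c Q M where pc: "(p has_integral c * (2 * pi) ^ CARD('d)) C"
    and Q: "\<forall>\<psi>. \<bar>Q \<psi>\<bar> \<le> M" "flow_deriv \<omega> Q (\<lambda>\<psi>. p \<psi> - c)"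
    using trig_poly_flow_primitive[OF p(1) nonres] unfolding C_def by blast
  have fi: "(f has_integral integral C f) C"
    unfolding C_def by (intro integrable_integral integrable_continuous continuous_on_subset[OF f(1)]) auto
  then have "((\<lambda>\<psi>. complex_of_real (f \<psi>)) has_integral complex_of_real (integral C f)) C"
    by (rule has_integral_of_real)
  then have "complex_of_real m = complex_of_real (integral C f / (2 * pi) ^ CARD('d))"
    unfolding mean fourier_coeff_def C_def[symmetric]
    by (simp add: real_vec_def zero_vec_def[symmetric] integral_unique)
  then have "integral C f = m * (2 * pi) ^ CARD('d)"
    unfolding of_real_eq_iff by simp
  then have "((\<lambda>\<psi>. f \<psi> - p \<psi>) has_integral (m - c) * (2 * pi) ^ CARD('d)) C"
    using has_integral_diff[OF fi pc] by (simp add: left_diff_distrib)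
  then have "norm ((m - c) * (2 * pi) ^ CARD('d)) \<le> e / 2 * measure lborel C"
    unfolding C_def by (rule has_integral_bound[rotated]) (use e p(2) in \<open>auto intro: less_imp_le\<close>)
  then have "\<bar>m - c\<bar> \<le> e / 2"
    by (simp add: vol abs_mult)
  then have "\<bar>f \<psi> - m - (p \<psi> - c)\<bar> \<le> e" for \<psi>
    using p(2)[of \<psi>] by linarith
  then show ?thesis using Q by blast
qed

section \<open>The response solution\<close>

lemma continuous_torus_periodic_bounded:
  fixes f :: "real ^ 'd \<Rightarrow> real"
  assumes "continuous_on UNIV f" "torus_periodic f"
  shows "\<exists>M. \<forall>\<psi>. \<bar>f \<psi>\<bar> \<le> M"
proof -
  define C where "C = cbox (\<chi> i. - pi) (\<chi> i. pi :: real ^ 'd)"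
  have "compact (f ` C)"
    unfolding C_def by (intro compact_continuous_image continuous_on_subset[OF assms(1)]) auto
  then obtain M where M: "\<forall>y\<in>f ` C. norm y \<le> M"
    using compact_imp_bounded bounded_iff by metis
  have "\<bar>f \<psi>\<bar> \<le> M" for \<psi>
  proof -
    have "f \<psi> = f (\<chi> i. Arg (cis (\<psi> $ i)))"
      by (rule torus_periodic_torus_point_eq[OF assms(2)])
        (simp add: torus_point_def cis_Arg sgn_div_norm)
    moreover have "(\<chi> i. Arg (cis (\<psi> $ i))) \<in> C"
      using Arg_bounded by (auto simp: C_def mem_box_cart less_imp_le)
    ultimately show ?thesis using M by auto
  qed
  then show ?thesis by blast
qed

definition torus_fun :: "(real ^ 'd \<Rightarrow> real) \<Rightarrow> bool" where
  "torus_fun H \<longleftrightarrow> continuous_on UNIV H \<and> torus_periodic H"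

lemma torus_fun_bounded: "torus_fun H \<Longrightarrow> \<exists>M. \<forall>\<psi>. \<bar>H \<psi>\<bar> \<le> M"
  unfolding torus_fun_def using continuous_torus_periodic_bounded by blast

lemma torus_fun_diff: "torus_fun H \<Longrightarrow> torus_fun H' \<Longrightarrow> torus_fun (\<lambda>\<psi>. H \<psi> - H' \<psi>)"
  unfolding torus_fun_def torus_periodic_def by (auto intro: continuous_on_diff)

lemma torus_fun_compose: "continuous_on UNIV h \<Longrightarrow> torus_fun H \<Longrightarrow> torus_fun (\<lambda>\<psi>. h (H \<psi>))"
  unfolding torus_fun_def torus_periodic_def by (auto intro: continuous_on_compose2)

lemma flow_linear_bound:
  assumes "l \<noteq> 0" "\<And>\<psi>. \<bar>U \<psi>\<bar> \<le> B" "flow_deriv \<omega> U (\<lambda>\<psi>. l * U \<psi> + H \<psi>)" "\<And>\<psi>. \<bar>H \<psi>\<bar> \<le> K"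
  shows "\<bar>U \<psi>\<bar> \<le> K / \<bar>l\<bar>"
  using bounded_linear_ode_bound[of l "\<lambda>t. U (\<psi> + t *\<^sub>R \<omega>)" B "\<lambda>t. H (\<psi> + t *\<^sub>R \<omega>)" K 0] assms
  by (simp add: flow_deriv_def)

text \<open>For \<open>l \<noteq> 0\<close> and a continuous periodic \<open>H\<close> the choice is
  forced: two candidates differ by a bounded solution of the homogeneous equation, which is 0.
  Linearity in \<open>H\<close> is never isolated; \<open>resolvent_diff_bound\<close> estimates
  differences directly.\<close>

definition resolvent :: "real ^ 'd \<Rightarrow> real \<Rightarrow> (real ^ 'd \<Rightarrow> real) \<Rightarrow> real ^ 'd \<Rightarrow> real" where
  "resolvent \<omega> l H = (SOME U. torus_fun U \<and> flow_deriv \<omega> U (\<lambda>\<psi>. l * U \<psi> + H \<psi>))"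

lemma resolvent:
  assumes "l \<noteq> 0" "torus_fun H"
  shows torus_fun_resolvent: "torus_fun (resolvent \<omega> l H)"
    and flow_deriv_resolvent:
      "flow_deriv \<omega> (resolvent \<omega> l H) (\<lambda>\<psi>. l * resolvent \<omega> l H \<psi> + H \<psi>)"
proof -
  have "\<exists>U. torus_fun U \<and> flow_deriv \<omega> U (\<lambda>\<psi>. l * U \<psi> + H \<psi>)"
    using resolvent_exists[OF assms(1), of H _ \<omega>] torus_fun_bounded[OF assms(2)] assms(2)
    unfolding torus_fun_def by blast
  from someI_ex[OF this] show "torus_fun (resolvent \<omega> l H)"
    and "flow_deriv \<omega> (resolvent \<omega> l H) (\<lambda>\<psi>. l * resolvent \<omega> l H \<psi> + H \<psi>)"
    unfolding resolvent_def by blast+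
qed

lemma resolvent_diff_bound:
  assumes l: "l \<noteq> 0" and H: "torus_fun H" "torus_fun H'" and K: "\<And>\<psi>. \<bar>H \<psi> - H' \<psi>\<bar> \<le> K"
  shows "\<bar>resolvent \<omega> l H \<psi> - resolvent \<omega> l H' \<psi>\<bar> \<le> K / \<bar>l\<bar>"
proof -
  let ?U = "\<lambda>\<psi>. resolvent \<omega> l H \<psi> - resolvent \<omega> l H' \<psi>"
  obtain B where "\<And>\<psi>. \<bar>?U \<psi>\<bar> \<le> B"
    using torus_fun_bounded[OF torus_fun_diff[OF torus_fun_resolvent[OF l H(1)] torus_fun_resolvent[OF l H(2)]]]
    by blast
  moreover have "flow_deriv \<omega> ?U (\<lambda>\<psi>. l * ?U \<psi> + (H \<psi> - H' \<psi>))"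
    using flow_deriv_diff[OF flow_deriv_resolvent[OF l H(1)] flow_deriv_resolvent[OF l H(2)], of \<omega>]
    by (simp add: algebra_simps)
  ultimately show ?thesis
    using flow_linear_bound[OF l, of ?U B \<omega> "\<lambda>\<psi>. H \<psi> - H' \<psi>" K \<psi>] K by blast
qed

text \<open>
  If \<open>F\<close> is \<open>e\<close>-close to the flow derivative of \<open>Q\<close>, then \<open>resolvent \<omega> l F - Q\<close> solves the same
  linear equation with forcing \<open>l Q + (F - D)\<close>, so no negative power of \<open>l\<close> hits \<open>Q\<close>.
\<close>
lemma resolvent_bound_primitive:
  assumes l: "l \<noteq> 0" and F: "torus_fun F" and Q: "\<And>\<psi>. \<bar>Q \<psi>\<bar> \<le> M" "flow_deriv \<omega> Q D"
    and e: "\<And>\<psi>. \<bar>F \<psi> - D \<psi>\<bar> \<le> e"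
  shows "\<bar>resolvent \<omega> l F \<psi>\<bar> \<le> 2 * M + e / \<bar>l\<bar>"
proof -
  let ?U = "\<lambda>\<psi>. resolvent \<omega> l F \<psi> - Q \<psi>"
  obtain B where B: "\<And>\<psi>. \<bar>resolvent \<omega> l F \<psi>\<bar> \<le> B"
    using torus_fun_bounded[OF torus_fun_resolvent[OF l F]] by blast
  have "\<bar>?U \<psi>\<bar> \<le> B + M" for \<psi>
    using B[of \<psi>] Q(1)[of \<psi>] by linarith
  moreover have "flow_deriv \<omega> ?U (\<lambda>\<psi>. l * ?U \<psi> + (l * Q \<psi> + (F \<psi> - D \<psi>)))"
    using flow_deriv_diff[OF flow_deriv_resolvent[OF l F] Q(2)] by (simp add: algebra_simps)
  moreover have "\<bar>l * Q \<psi> + (F \<psi> - D \<psi>)\<bar> \<le> \<bar>l\<bar> * M + e" for \<psi>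
    using e[of \<psi>] mult_left_mono[OF Q(1), of "\<bar>l\<bar>" \<psi>] by (simp add: abs_mult[symmetric])
  ultimately have "\<bar>?U \<psi>\<bar> \<le> (\<bar>l\<bar> * M + e) / \<bar>l\<bar>"
    by (rule flow_linear_bound[OF l])
  also have "\<dots> = M + e / \<bar>l\<bar>" using l by (simp add: field_simps)
  finally show ?thesis using Q(1)[of \<psi>] by linarith
qed

lemma closed_torus_bcontfun: "closed {\<Phi> :: (real ^ 'd) \<Rightarrow>\<^sub>C real. torus_periodic (apply_bcontfun \<Phi>)}"
proof -
  have lim: "(\<lambda>n. apply_bcontfun (X n) y) \<longlonglongrightarrow> apply_bcontfun \<Phi> y"
    if "X \<longlonglongrightarrow> \<Phi>" for X and \<Phi> :: "(real ^ 'd) \<Rightarrow>\<^sub>C real" and y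
    using tendsto_bcontfun_uniform_limit[OF that] tendsto_uniform_limitI by fastforce
  show ?thesis
    unfolding closed_sequential_limits
  proof (intro allI impI, elim conjE, rule CollectI)
    fix X and \<Phi> :: "(real ^ 'd) \<Rightarrow>\<^sub>C real"
    assume X: "\<forall>n. X n \<in> {\<Phi>. torus_periodic (apply_bcontfun \<Phi>)}" and "X \<longlonglongrightarrow> \<Phi>"
    note L = lim[OF \<open>X \<longlonglongrightarrow> \<Phi>\<close>]
    show "torus_periodic (apply_bcontfun \<Phi>)"
      unfolding torus_periodic_def
    proof (intro allI)
      fix \<psi> i
      have "(\<lambda>n. apply_bcontfun (X n) (\<psi> + axis i (2 * pi))) = (\<lambda>n. apply_bcontfun (X n) \<psi>)"
        using X by (auto simp: torus_periodic_def)
      then show "apply_bcontfun \<Phi> (\<psi> + axis i (2 * pi)) = apply_bcontfun \<Phi> \<psi>"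
        using L[of "\<psi> + axis i (2 * pi)"] L[of \<psi>] LIMSEQ_unique by fastforce
    qed
  qed
qed

text \<open>The constant \<open>\<bar>l1 * l2\<bar> / 2\<close> is matched to the two inverses, of
  norms \<open>1 / \<bar>l1\<bar>\<close> and \<open>1 / \<bar>l2\<bar>\<close>, so the contraction
  factor is exactly 1/2. Together with \<open>small\<close>, which bounds the image of 0 by
  \<open>\<rho> / 2\<close>, this maps the ball of radius \<open>\<rho>\<close> into itself. The
  intermediate function \<open>q\<close> is kept in the conclusion because \<open>Y\<close> acquires
  its second derivative along the flow through it.\<close>

lemma response_fixed_point:
  fixes F :: "real ^ 'd \<Rightarrow> real" and N :: "real \<Rightarrow> real"
  assumes l: "l1 \<noteq> 0" "l2 \<noteq> 0" and F: "torus_fun F" and Nc: "continuous_on UNIV N" and N0: "N 0 = 0"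
    and \<rho>: "\<rho> > 0"
    and lip: "\<And>y z. \<bar>y\<bar> \<le> \<rho> \<Longrightarrow> \<bar>z\<bar> \<le> \<rho> \<Longrightarrow> \<bar>N y - N z\<bar> \<le> \<bar>l1 * l2\<bar> / 2 * \<bar>y - z\<bar>"
    and small: "\<And>\<psi>. \<bar>resolvent \<omega> l2 (resolvent \<omega> l1 F) \<psi>\<bar> \<le> \<rho> / 2"
  shows "\<exists>Y q. torus_fun Y \<and> (\<forall>\<psi>. \<bar>Y \<psi>\<bar> \<le> \<rho>) \<and>
           flow_deriv \<omega> q (\<lambda>\<psi>. l1 * q \<psi> + (F \<psi> - N (Y \<psi>))) \<and>
           flow_deriv \<omega> Y (\<lambda>\<psi>. l2 * Y \<psi> + q \<psi>)"
proof -
  define G where "G Y \<psi> = F \<psi> - N (Y \<psi>)" for Y \<psi>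
  define T where "T Y = resolvent \<omega> l2 (resolvent \<omega> l1 (G Y))" for Y
  define S where "S = {\<Phi> :: (real ^ 'd) \<Rightarrow>\<^sub>C real. torus_periodic (apply_bcontfun \<Phi>)} \<inter> cball 0 \<rho>"
  \<comment> \<open>\<open>Bcontfun\<close> is meaningful only for bounded continuous arguments, so
    \<open>A\<close> is identified with \<open>T\<close> only on \<open>S\<close>.\<close>
  define A where "A \<Phi> = Bcontfun (T (apply_bcontfun \<Phi>))" for \<Phi>
  have G: "torus_fun (G Y)" if "torus_fun Y" for Y
    unfolding G_def by (intro torus_fun_diff F torus_fun_compose[OF Nc] that)
  have T: "torus_fun (T Y)" if "torus_fun Y" for Y
    unfolding T_def by (intro torus_fun_resolvent l G that)
  have T_diff: "\<bar>T Y \<psi> - T Z \<psi>\<bar> \<le> d / 2"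
    if Y: "torus_fun Y" "\<And>\<psi>. \<bar>Y \<psi>\<bar> \<le> \<rho>" and Z: "torus_fun Z" "\<And>\<psi>. \<bar>Z \<psi>\<bar> \<le> \<rho>"
      and d: "\<And>\<psi>. \<bar>Y \<psi> - Z \<psi>\<bar> \<le> d" for Y Z d \<psi>
  proof -
    have GG: "\<bar>G Y \<psi> - G Z \<psi>\<bar> \<le> \<bar>l1 * l2\<bar> / 2 * d" for \<psi>
    proof -
      have "\<bar>N (Y \<psi>) - N (Z \<psi>)\<bar> \<le> \<bar>l1 * l2\<bar> / 2 * \<bar>Y \<psi> - Z \<psi>\<bar>" by (rule lip) (rule Y Z)+
      also have "\<dots> \<le> \<bar>l1 * l2\<bar> / 2 * d" by (intro mult_left_mono d) auto
      finally show ?thesis by (simp add: G_def abs_minus_commute)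
    qed
    have "\<bar>T Y \<psi> - T Z \<psi>\<bar> \<le> \<bar>l1 * l2\<bar> / 2 * d / \<bar>l1\<bar> / \<bar>l2\<bar>"
      unfolding T_def by (intro resolvent_diff_bound torus_fun_resolvent l G Y Z GG)
    also have "\<dots> = d / 2" using l by (simp add: abs_mult)
    finally show ?thesis .
  qed
  have T0: "\<bar>T (\<lambda>_. 0) \<psi>\<bar> \<le> \<rho> / 2" for \<psi>
    using small by (simp add: T_def G_def[abs_def] N0)
  have zero: "torus_fun (\<lambda>_. 0)" by (simp add: torus_fun_def torus_periodic_def)
  have T_bound: "\<bar>T Y \<psi>\<bar> \<le> \<rho>" if "torus_fun Y" "\<And>\<psi>. \<bar>Y \<psi>\<bar> \<le> \<rho>" for Y \<psi>
  proof -
    have "\<bar>T Y \<psi> - T (\<lambda>_. 0) \<psi>\<bar> \<le> \<rho> / 2"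
      by (rule T_diff[OF that zero]) (use that(2) \<rho> in auto)
    then show ?thesis using T0[of \<psi>] by linarith
  qed
  have S: "torus_fun (apply_bcontfun \<Phi>)" "\<bar>apply_bcontfun \<Phi> \<psi>\<bar> \<le> \<rho>" if "\<Phi> \<in> S" for \<Phi> \<psi>
    using that norm_bounded[of \<Phi> \<psi>] by (auto simp: S_def torus_fun_def)
  have A: "apply_bcontfun (A \<Phi>) = T (apply_bcontfun \<Phi>)" if "\<Phi> \<in> S" for \<Phi>
    unfolding A_def
    by (rule Bcontfun_inverse, rule bcontfun_normI[of _ \<rho>])
      (use T[OF S(1)[OF that]] T_bound[OF S[OF that]] in \<open>auto simp: torus_fun_def\<close>)
  have "\<exists>!\<Phi>\<in>S. A \<Phi> = \<Phi>"
  proof (rule Banach_fix)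
    show "complete S"
      unfolding S_def complete_eq_closed by (intro closed_Int closed_torus_bcontfun closed_cball)
    have "0 \<in> S" using \<rho> by (simp add: S_def torus_periodic_def)
    then show "S \<noteq> {}" by blast
    show "A ` S \<subseteq> S"
    proof safe
      fix \<Phi> assume \<Phi>: "\<Phi> \<in> S"
      have "norm (A \<Phi>) \<le> \<rho>"
        by (rule norm_bound) (use A[OF \<Phi>] T_bound[OF S[OF \<Phi>]] in simp)
      then show "A \<Phi> \<in> S"
        using T[OF S(1)[OF \<Phi>]] A[OF \<Phi>] by (simp add: S_def torus_fun_def)
    qed
    show "dist (A \<Phi>) (A \<Psi>) \<le> 1 / 2 * dist \<Phi> \<Psi>" if "\<Phi> \<in> S" "\<Psi> \<in> S" for \<Phi> \<Psi>
    proof (rule dist_bound)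
      fix \<psi>
      show "dist (apply_bcontfun (A \<Phi>) \<psi>) (apply_bcontfun (A \<Psi>) \<psi>) \<le> 1 / 2 * dist \<Phi> \<Psi>"
        using T_diff[OF S[OF that(1)] S[OF that(2)], of "dist \<Phi> \<Psi>" \<psi>] dist_bounded[of \<Phi> _ \<Psi>]
        by (simp add: A that dist_real_def)
    qed
  qed auto
  then obtain \<Phi> where \<Phi>: "\<Phi> \<in> S" "A \<Phi> = \<Phi>" by blast
  define Y where "Y = apply_bcontfun \<Phi>"
  have Y: "torus_fun Y" "\<And>\<psi>. \<bar>Y \<psi>\<bar> \<le> \<rho>" "T Y = Y"
    using S[OF \<Phi>(1)] A[OF \<Phi>(1)] \<Phi>(2) by (auto simp: Y_def)
  have "flow_deriv \<omega> (resolvent \<omega> l1 (G Y)) (\<lambda>\<psi>. l1 * resolvent \<omega> l1 (G Y) \<psi> + (F \<psi> - N (Y \<psi>)))"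
    using flow_deriv_resolvent[OF l(1) G[OF Y(1)]] by (simp add: G_def)
  moreover have "flow_deriv \<omega> Y (\<lambda>\<psi>. l2 * Y \<psi> + resolvent \<omega> l1 (G Y) \<psi>)"
    using flow_deriv_resolvent[OF l(2) torus_fun_resolvent[OF l(1) G[OF Y(1)], of \<omega>], of \<omega>]
    using Y(3) by (simp add: T_def)
  ultimately show ?thesis using Y by blast
qed

section \<open>Uniqueness and stability\<close>

lemma C1_local_lipschitz:
  fixes g :: "real \<Rightarrow> real"
  assumes g: "\<And>x. (g has_real_derivative deriv g x) (at x)" "\<And>x. isCont (deriv g) x"
  shows "\<exists>L\<ge>0. \<forall>u v. \<bar>u\<bar> \<le> M \<longrightarrow> \<bar>v\<bar> \<le> M \<longrightarrow> \<bar>g u - g v\<bar> \<le> L * \<bar>u - v\<bar>"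
proof -
  have "compact (deriv g ` {-M..M})"
    by (intro compact_continuous_image continuous_at_imp_continuous_on ballI g compact_Icc)
  then obtain L where L: "\<forall>y\<in>deriv g ` {-M..M}. norm y \<le> L"
    using compact_imp_bounded bounded_iff by metis
  \<comment> \<open>For negative \<open>M\<close> the interval is empty and \<open>L\<close> may be
    negative; the maximum covers this case.\<close>
  have "norm (g u - g v) \<le> max L 0 * norm (u - v)" if "\<bar>u\<bar> \<le> M" "\<bar>v\<bar> \<le> M" for u v
  proof (rule field_differentiable_bound[of "{-M..M}"])
    show "(g has_real_derivative deriv g z) (at z within {-M..M})" for z
      using g(1) has_field_derivative_at_within by blast
    show "norm (deriv g z) \<le> max L 0" if "z \<in> {-M..M}" for z
      using L that by (auto intro: max.coboundedI1)
  qed (use that in auto)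
  then show ?thesis by (intro exI[of _ "max L 0"]) auto
qed

lemma C1_linearization:
  fixes g :: "real \<Rightarrow> real"
  assumes g: "\<And>x. (g has_real_derivative deriv g x) (at x)" "isCont (deriv g) c" and e: "e > 0"
  shows "\<exists>\<rho>>0. \<forall>u v. \<bar>u - c\<bar> \<le> \<rho> \<longrightarrow> \<bar>v - c\<bar> \<le> \<rho> \<longrightarrow> \<bar>g u - g v - deriv g c * (u - v)\<bar> \<le> e * \<bar>u - v\<bar>"
proof -
  obtain \<delta> where \<delta>: "\<delta> > 0" "\<And>x. dist x c < \<delta> \<Longrightarrow> dist (deriv g x) (deriv g c) < e"
    using g(2) e unfolding continuous_at_eps_delta by blast
  have "norm ((g u - deriv g c * u) - (g v - deriv g c * v)) \<le> e * norm (u - v)"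
    if "\<bar>u - c\<bar> \<le> \<delta> / 2" "\<bar>v - c\<bar> \<le> \<delta> / 2" for u v
  proof (rule field_differentiable_bound[of "cball c (\<delta> / 2)"])
    show "((\<lambda>u. g u - deriv g c * u) has_real_derivative deriv g z - deriv g c) (at z within cball c (\<delta> / 2))" for z
      by (rule has_field_derivative_at_within) (rule derivative_eq_intros g(1) refl | simp)+
    show "norm (deriv g z - deriv g c) \<le> e" if "z \<in> cball c (\<delta> / 2)" for z
      using \<delta>(2)[of z] \<delta>(1) that by (simp add: dist_commute dist_norm)
  qed (use that abs_minus_commute[of c u] abs_minus_commute[of c v] in \<open>auto simp: dist_real_def\<close>)
  then show ?thesis using \<delta>(1)
    by (intro exI[of _ "\<delta> / 2"]) (simp add: algebra_simps)
qed

lemma solves_on_subset: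
  "solves_on \<epsilon> \<omega> g f T x v \<Longrightarrow> S \<subseteq> T \<Longrightarrow> solves_on \<epsilon> \<omega> g f S x v"
  unfolding solves_on_def by (meson has_field_derivative_subset subsetD)

text \<open>A Gronwall argument on \<open>{0..t}\<close>: both solutions stay in a compact set
  there, so \<open>g\<close> is Lipschitz along them, and the squared distance of the phase points
  with weight \<open>exp (- K * s)\<close> cannot grow from its initial value 0.\<close>

lemma solves_on_unique:
  assumes g: "\<And>x. (g has_real_derivative deriv g x) (at x)" "\<And>x. isCont (deriv g) x"
    and e: "\<epsilon> \<noteq> 0"
    and z: "solves_on \<epsilon> \<omega> g f {0..<\<tau>} z u" and y: "solves_on \<epsilon> \<omega> g f {0..<\<tau>} y w"
    and init: "z 0 = y 0" "u 0 = w 0" and t: "t \<in> {0..<\<tau>}"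
  shows "z t = y t \<and> u t = w t"
proof -
  have sub: "{0..t} \<subseteq> {0..<\<tau>}" using t by auto
  have cont: "continuous_on {0..t} z" "continuous_on {0..t} u" "continuous_on {0..t} y" "continuous_on {0..t} w"
    using solves_on_subset[OF z sub] solves_on_subset[OF y sub] unfolding solves_on_def
    by (meson DERIV_continuous_on)+
  obtain Mz My where "\<forall>s\<in>z ` {0..t}. norm s \<le> Mz" "\<forall>s\<in>y ` {0..t}. norm s \<le> My"
    using compact_imp_bounded[OF compact_continuous_image[OF cont(1)]]
      compact_imp_bounded[OF compact_continuous_image[OF cont(3)]] unfolding bounded_iff by blast
  then have M: "\<bar>z s\<bar> \<le> max Mz My" "\<bar>y s\<bar> \<le> max Mz My" if "s \<in> {0..t}" for s
    using that by (auto intro: max.coboundedI1 max.coboundedI2)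
  obtain L where L: "L \<ge> 0" "\<And>p q. \<bar>p\<bar> \<le> max Mz My \<Longrightarrow> \<bar>q\<bar> \<le> max Mz My \<Longrightarrow> \<bar>g p - g q\<bar> \<le> L * \<bar>p - q\<bar>"
    using C1_local_lipschitz[OF g] by meson
  \<comment> \<open>The 1 absorbs the coupling of position and velocity, \<open>L\<close> the
    nonlinearity, and \<open>2 / \<bar>\<epsilon>\<bar>\<close> the term with
    \<open>1 / \<epsilon>\<close>, which may be amplifying since the sign of \<epsilon> is not
    fixed.\<close>
  define K where "K = 1 + L + 2 / \<bar>\<epsilon>\<bar>"
  define E where "E s = ((z s - y s)\<^sup>2 + (u s - w s)\<^sup>2) * exp (- K * s)" for s
  \<comment> \<open>At time 0 only a one-sided derivative is available, so monotonicity is derived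
    from derivatives in the open interval and continuity up to its ends.\<close>
  have "E t \<le> E 0"
  proof (rule DERIV_nonpos_imp_decreasing_open[of 0 t E])
    show "0 \<le> t" using t by simp
    show "continuous_on {0..t} E"
      unfolding E_def by (intro continuous_intros cont)
    fix s assume s: "0 < s" "s < t"
    have at: "at s within {0..<\<tau>} = at s"
      by (rule at_within_interior) (use s t in \<open>auto simp: interior_atLeastLessThan\<close>)
    have s\<tau>: "s \<in> {0..<\<tau>}" using s t by auto
    from bspec[OF z[unfolded solves_on_def] s\<tau>] obtain a where
      z': "(z has_real_derivative u s) (at s)" "(u has_real_derivative a) (at s)"
      "\<epsilon> * a + u s + \<epsilon> * g (z s) = \<epsilon> * f (s *\<^sub>R \<omega>)" unfolding at by blast
    from bspec[OF y[unfolded solves_on_def] s\<tau>] obtain b where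
      y': "(y has_real_derivative w s) (at s)" "(w has_real_derivative b) (at s)"
      "\<epsilon> * b + w s + \<epsilon> * g (y s) = \<epsilon> * f (s *\<^sub>R \<omega>)" unfolding at by blast
    define d where "d = z s - y s"
    define c where "c = u s - w s"
    define G where "G = g (z s) - g (y s)"
    have "\<epsilon> * (a - b) = - c - \<epsilon> * G"
      unfolding right_diff_distrib c_def G_def using z'(3) y'(3) by linarith
    then have ab: "a - b = - c / \<epsilon> - G" using e by (simp add: field_simps)
    have G: "\<bar>G\<bar> \<le> L * \<bar>d\<bar>"
      unfolding G_def d_def by (intro L(2) M) (use s in auto)
    have "2 * d * c + 2 * c * (a - b) \<le> K * (d\<^sup>2 + c\<^sup>2)"
    proof -
      have dc: "2 * \<bar>d\<bar> * \<bar>c\<bar> \<le> d\<^sup>2 + c\<^sup>2"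
        using sum_squares_bound[of "\<bar>d\<bar>" "\<bar>c\<bar>"] by simp
      have "2 * d * c \<le> 2 * \<bar>d\<bar> * \<bar>c\<bar>"
        using abs_ge_self[of "d * c"] by (simp add: abs_mult)
      moreover have "- 2 * c * G \<le> L * (d\<^sup>2 + c\<^sup>2)"
      proof -
        have "- 2 * c * G \<le> 2 * \<bar>c\<bar> * \<bar>G\<bar>"
          using abs_ge_minus_self[of "c * G"] by (simp add: abs_mult mult.commute)
        also have "\<dots> \<le> 2 * \<bar>c\<bar> * (L * \<bar>d\<bar>)" by (intro mult_left_mono G) auto
        also have "\<dots> = L * (2 * \<bar>d\<bar> * \<bar>c\<bar>)" by simp
        also have "\<dots> \<le> L * (d\<^sup>2 + c\<^sup>2)" by (intro mult_left_mono dc L)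
        finally show ?thesis .
      qed
      moreover have "- 2 * c * (c / \<epsilon>) \<le> 2 / \<bar>\<epsilon>\<bar> * (d\<^sup>2 + c\<^sup>2)"
      proof -
        have "- 2 * c * (c / \<epsilon>) \<le> \<bar>- 2 * c * (c / \<epsilon>)\<bar>" by (rule abs_ge_self)
        also have "\<dots> = 2 / \<bar>\<epsilon>\<bar> * c\<^sup>2" by (simp add: abs_mult power2_eq_square)
        also have "\<dots> \<le> 2 / \<bar>\<epsilon>\<bar> * (d\<^sup>2 + c\<^sup>2)" by (intro mult_left_mono) auto
        finally show ?thesis .
      qed
      ultimately show ?thesis
        using dc unfolding ab K_def by (simp add: algebra_simps)
    qed
    then have "(2 * d * c + 2 * c * (a - b) - K * (d\<^sup>2 + c\<^sup>2)) * exp (- K * s) \<le> 0"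
      by (intro mult_nonpos_nonneg) auto
    moreover have "(E has_real_derivative (2 * d * c + 2 * c * (a - b) - K * (d\<^sup>2 + c\<^sup>2)) * exp (- K * s)) (at s)"
      unfolding E_def d_def c_def
      by (rule derivative_eq_intros z' y' refl | simp)+ (simp add: algebra_simps)
    ultimately show "\<exists>y. (E has_real_derivative y) (at s) \<and> y \<le> 0" by blast
  qed
  then have "(z t - y t)\<^sup>2 + (u t - w t)\<^sup>2 \<le> 0"
    using init by (simp add: E_def mult_le_0_iff)
  then show ?thesis by (simp add: sum_power2_le_zero_iff)
qed

section \<open>Variation of constants with exponential weights\<close>

definition duhamel :: "real \<Rightarrow> (real \<Rightarrow> real) \<Rightarrow> real \<Rightarrow> real \<Rightarrow> real" where
  "duhamel k h q t = exp (- k * t) * (q + integral {0..t} (\<lambda>s. exp (k * s) * h s))"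

lemma duhamel_0 [simp]: "duhamel k h q 0 = q"
  by (simp add: duhamel_def)

lemma duhamel_deriv:
  assumes h: "continuous_on {0..} h" and t: "t \<ge> 0"
  shows "(duhamel k h q has_real_derivative - k * duhamel k h q t + h t) (at t within {0..})"
proof -
  \<comment> \<open>The upper end \<open>t + 1\<close> keeps \<open>t\<close> away from the right
    endpoint, so that the derivative within the interval is the one within the half-line.\<close>
  have at: "at t within {0..t + 1} = at t within {0..}"
    by (rule at_within_nhd[of _ "{..<t + 1}"]) auto
  define J where "J t = integral {0..t} (\<lambda>s. exp (k * s) * h s)" for t
  have "(J has_real_derivative exp (k * t) * h t) (at t within {0..t + 1})"
    unfolding J_def
    using t by (intro integral_has_real_derivative continuous_intros continuous_on_subset[OF h]) auto
  note J = this[unfolded at]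
  have "((\<lambda>t. exp (- k * t) * (q + J t)) has_real_derivative
      - k * (exp (- k * t) * (q + J t)) + exp (- k * t) * (exp (k * t) * h t)) (at t within {0..})"
    by (rule derivative_eq_intros J refl | simp)+
  moreover have "exp (- k * t) * (exp (k * t) * h t) = h t" by (simp add: exp_minus)
  ultimately show ?thesis
    unfolding duhamel_def J_def by (simp only:)
qed

lemma duhamel_continuous: "continuous_on {0..} h \<Longrightarrow> continuous_on {0..} (duhamel k h q)"
  using duhamel_deriv by (auto intro!: DERIV_continuous_on)

lemma duhamel_diff:
  assumes h: "continuous_on {0..} h" "continuous_on {0..} h'"
  shows "duhamel k h q t - duhamel k h' q t = duhamel k (\<lambda>s. h s - h' s) 0 t"
proof -
  have "(\<lambda>s. exp (k * s) * H s) integrable_on {0..t}" if "continuous_on {0..} H" for H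
    by (intro integrable_continuous_real continuous_intros continuous_on_subset[OF that]) auto
  then show ?thesis
    using integral_diff[of "\<lambda>s. exp (k * s) * h s" "{0..t}" "\<lambda>s. exp (k * s) * h' s"] h
    by (simp add: duhamel_def right_diff_distrib distrib_left)
qed

text \<open>Forcing that decays at a rate \<open>\<mu>\<close> strictly below \<open>k\<close>
  passes its rate on to the solution, with gain \<open>1 / (k - \<mu>)\<close>. At equal rates the
  integral would contribute a factor \<open>t\<close>; hence the strict gap.\<close>

lemma duhamel_bound:
  assumes h: "continuous_on {0..} h" and b: "\<And>s. s \<ge> 0 \<Longrightarrow> \<bar>h s\<bar> \<le> M * exp (- \<mu> * s)"
    and M: "M \<ge> 0" and k: "\<mu> < k" and t: "t \<ge> 0"
  shows "\<bar>duhamel k h q t\<bar> \<le> (\<bar>q\<bar> + M / (k - \<mu>)) * exp (- \<mu> * t)"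
proof -
  have "((\<lambda>s. M * exp ((k - \<mu>) * s)) has_integral (M / (k - \<mu>) * exp ((k - \<mu>) * t) - M / (k - \<mu>) * exp ((k - \<mu>) * 0))) {0..t}"
  proof (rule fundamental_theorem_of_calculus[OF t])
    fix s
    have "((\<lambda>s. M / (k - \<mu>) * exp ((k - \<mu>) * s)) has_real_derivative M * exp ((k - \<mu>) * s)) (at s within {0..t})"
      using k by (auto intro!: derivative_eq_intros)
    then show "((\<lambda>s. M / (k - \<mu>) * exp ((k - \<mu>) * s)) has_vector_derivative M * exp ((k - \<mu>) * s)) (at s within {0..t})"
      by (simp add: has_real_derivative_iff_has_vector_derivative)
  qed
  note I = this
  have "norm (integral {0..t} (\<lambda>s. exp (k * s) * h s)) \<le> integral {0..t} (\<lambda>s. M * exp ((k - \<mu>) * s))"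
  proof (rule integral_norm_bound_integral)
    show "(\<lambda>s. exp (k * s) * h s) integrable_on {0..t}"
      by (intro integrable_continuous_real continuous_intros continuous_on_subset[OF h]) auto
    show "(\<lambda>s. M * exp ((k - \<mu>) * s)) integrable_on {0..t}" using I by blast
    fix s assume "s \<in> {0..t}"
    then have "exp (k * s) * \<bar>h s\<bar> \<le> exp (k * s) * (M * exp (- \<mu> * s))"
      by (intro mult_left_mono b) auto
    also have "\<dots> = M * exp ((k - \<mu>) * s)" by (simp add: left_diff_distrib exp_diff exp_minus field_simps)
    finally show "norm (exp (k * s) * h s) \<le> M * exp ((k - \<mu>) * s)" by (simp add: abs_mult)
  qed
  also have "\<dots> \<le> M / (k - \<mu>) * exp ((k - \<mu>) * t)"
    using integral_unique[OF I] M k by simp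
  finally have "\<bar>integral {0..t} (\<lambda>s. exp (k * s) * h s)\<bar> \<le> M / (k - \<mu>) * exp ((k - \<mu>) * t)" by simp
  moreover have "\<bar>q\<bar> \<le> \<bar>q\<bar> * exp ((k - \<mu>) * t)"
    using k t by (intro mult_le_cancel_left1[THEN iffD2]) auto
  ultimately have "\<bar>q + integral {0..t} (\<lambda>s. exp (k * s) * h s)\<bar> \<le> (\<bar>q\<bar> + M / (k - \<mu>)) * exp ((k - \<mu>) * t)"
    unfolding distrib_right by linarith
  then have "\<bar>duhamel k h q t\<bar> \<le> exp (- k * t) * ((\<bar>q\<bar> + M / (k - \<mu>)) * exp ((k - \<mu>) * t))"
    unfolding duhamel_def abs_mult by (simp add: mult_left_mono)
  also have "\<dots> = (\<bar>q\<bar> + M / (k - \<mu>)) * exp (- \<mu> * t)"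
    by (simp add: left_diff_distrib exp_diff exp_minus field_simps)
  finally show ?thesis .
qed

text \<open>
  The contraction acts on \<open>Z t = exp (k1 t / 2) z t\<close>, so that the sup norm of \<open>Z\<close> encodes
  exponential decay of \<open>z\<close>; \<open>Z\<close> is extended to negative times by its value at \<open>0\<close>.
\<close>
lemma stable_perturbation:
  fixes n :: "real \<Rightarrow> real \<Rightarrow> real"
  assumes k: "k1 > 0" "k1 \<le> k2" and \<rho>: "\<rho> > 0"
    and nc: "continuous_on UNIV (\<lambda>(t, z). n t z)" and n0: "\<And>t. n t 0 = 0"
    and lip: "\<And>t y z. \<bar>y\<bar> \<le> \<rho> \<Longrightarrow> \<bar>z\<bar> \<le> \<rho> \<Longrightarrow> \<bar>n t y - n t z\<bar> \<le> k1 * k2 / 8 * \<bar>y - z\<bar>"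
    and init: "\<bar>z0\<bar> + 2 * \<bar>q0\<bar> / k1 \<le> \<rho> / 2"
  shows "\<exists>z q C. z 0 = z0 \<and> q 0 = q0 \<and>
     (\<forall>t\<ge>0. (z has_real_derivative - k1 * z t + q t) (at t within {0..}) \<and>
            (q has_real_derivative - k2 * q t + n t (z t)) (at t within {0..}) \<and>
            \<bar>z t\<bar> \<le> \<rho> * exp (- (k1 / 2) * t) \<and> \<bar>q t\<bar> \<le> C * exp (- (k1 / 2) * t))"
proof -
  \<comment> \<open>Half the smaller rate leaves the gaps \<open>k1 - \<mu> = k1 / 2\<close> and
    \<open>k2 - \<mu> \<ge> k2 / 2\<close>. The Lipschitz constant \<open>k1 * k2 / 8\<close> thus
    becomes \<open>k1 / 4\<close> after the first integration and 1/2 after the second.\<close>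
  define \<mu> where "\<mu> = k1 / 2"
  define nn where "nn Z r = n r (exp (- \<mu> * r) * Z r)" for Z r
  define Q where "Q Z = duhamel k2 (nn Z) q0" for Z
  define P where "P Z = duhamel k1 (Q Z) z0" for Z
  define A where "A Z = Bcontfun (\<lambda>t. exp (\<mu> * max 0 t) * P (apply_bcontfun Z) (max 0 t))" for Z
  have nnc: "continuous_on {0..} (nn Z)" if "continuous_on UNIV Z" for Z
  proof -
    have "continuous_on {0..} (\<lambda>r. case (r, exp (- \<mu> * r) * Z r) of (t, z) \<Rightarrow> n t z)"
      by (rule continuous_on_compose2[OF nc])
        (auto intro!: continuous_intros continuous_on_subset[OF that])
    then show ?thesis by (simp add: nn_def[abs_def])
  qed
  have Qc: "continuous_on {0..} (Q Z)" if "continuous_on UNIV Z" for Z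
    unfolding Q_def by (intro duhamel_continuous nnc that)
  have Pc: "continuous_on {0..} (P Z)" if "continuous_on UNIV Z" for Z
    unfolding P_def by (intro duhamel_continuous Qc that)
  have small: "\<bar>exp (- \<mu> * r) * Z r\<bar> \<le> \<rho>" if "\<And>r. \<bar>Z r\<bar> \<le> \<rho>" "r \<ge> 0" for Z r
  proof -
    have "exp (- \<mu> * r) * \<bar>Z r\<bar> \<le> 1 * \<rho>"
      using that k by (intro mult_mono) (auto simp: \<mu>_def)
    then show ?thesis by (simp add: abs_mult)
  qed
  have nn_diff: "\<bar>nn Y r - nn Z r\<bar> \<le> k1 * k2 / 8 * d * exp (- \<mu> * r)"
    if "\<And>r. \<bar>Y r\<bar> \<le> \<rho>" "\<And>r. \<bar>Z r\<bar> \<le> \<rho>" "\<And>r. \<bar>Y r - Z r\<bar> \<le> d" "r \<ge> 0" for Y Z d r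
  proof -
    have "\<bar>nn Y r - nn Z r\<bar> \<le> k1 * k2 / 8 * \<bar>exp (- \<mu> * r) * Y r - exp (- \<mu> * r) * Z r\<bar>"
      unfolding nn_def by (intro lip small that)
    also have "\<dots> = k1 * k2 / 8 * \<bar>Y r - Z r\<bar> * exp (- \<mu> * r)"
      by (simp add: right_diff_distrib[symmetric] abs_mult)
    also have "\<dots> \<le> k1 * k2 / 8 * d * exp (- \<mu> * r)"
      using k that by (intro mult_right_mono mult_left_mono) auto
    finally show ?thesis .
  qed
  have gap: "k1 * k2 / 8 * d / (k2 - \<mu>) \<le> k1 / 4 * d" if "d \<ge> 0" for d
  proof -
    have "k1 * k2 / 8 * d = k1 / 4 * d * (k2 / 2)" by simp
    also have "\<dots> \<le> k1 / 4 * d * (k2 - \<mu>)"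
      using k that by (intro mult_left_mono) (auto simp: \<mu>_def)
    finally have "k1 * k2 / 8 * d \<le> k1 / 4 * d * (k2 - \<mu>)" .
    moreover have "k2 - \<mu> > 0" using k by (simp add: \<mu>_def)
    ultimately show ?thesis by (simp only: pos_divide_le_eq)
  qed
  have Q_bound: "\<bar>Q Z t\<bar> \<le> (\<bar>q0\<bar> + k1 / 4 * \<rho>) * exp (- \<mu> * t)"
    if Z: "continuous_on UNIV Z" "\<And>r. \<bar>Z r\<bar> \<le> \<rho>" and t: "t \<ge> 0" for Z t
  proof -
    have "\<bar>nn Z s\<bar> \<le> k1 * k2 / 8 * \<rho> * exp (- \<mu> * s)" if "s \<ge> 0" for s
      using nn_diff[of Z "\<lambda>_. 0" \<rho> s] Z(2) \<rho> that by (simp add: nn_def n0)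
    then have "\<bar>Q Z t\<bar> \<le> (\<bar>q0\<bar> + k1 * k2 / 8 * \<rho> / (k2 - \<mu>)) * exp (- \<mu> * t)"
      unfolding Q_def using k \<rho> t by (intro duhamel_bound nnc Z) (auto simp: \<mu>_def)
    also have "\<dots> \<le> (\<bar>q0\<bar> + k1 / 4 * \<rho>) * exp (- \<mu> * t)"
      using gap[of \<rho>] \<rho> by (intro mult_right_mono) auto
    finally show ?thesis .
  qed
  have P_bound: "\<bar>P Z t\<bar> \<le> \<rho> * exp (- \<mu> * t)"
    if Z: "continuous_on UNIV Z" "\<And>r. \<bar>Z r\<bar> \<le> \<rho>" and t: "t \<ge> 0" for Z t
  proof -
    have "\<bar>P Z t\<bar> \<le> (\<bar>z0\<bar> + (\<bar>q0\<bar> + k1 / 4 * \<rho>) / (k1 - \<mu>)) * exp (- \<mu> * t)"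
      unfolding P_def using k \<rho> t by (intro duhamel_bound Qc Q_bound Z) (auto simp: \<mu>_def)
    \<comment> \<open>The nonlinearity uses up half of the radius and the initial data, by
      \<open>init\<close>, the other half.\<close>
    also have "\<bar>z0\<bar> + (\<bar>q0\<bar> + k1 / 4 * \<rho>) / (k1 - \<mu>) = \<bar>z0\<bar> + 2 * \<bar>q0\<bar> / k1 + \<rho> / 2"
      using k by (simp add: \<mu>_def field_simps)
    also have "(\<bar>z0\<bar> + 2 * \<bar>q0\<bar> / k1 + \<rho> / 2) * exp (- \<mu> * t) \<le> \<rho> * exp (- \<mu> * t)"
      using init by (intro mult_right_mono) auto
    finally show ?thesis .
  qed
  have P_diff: "\<bar>P Y t - P Z t\<bar> \<le> d / 2 * exp (- \<mu> * t)"
    if Y: "continuous_on UNIV Y" "\<And>r. \<bar>Y r\<bar> \<le> \<rho>" and Z: "continuous_on UNIV Z" "\<And>r. \<bar>Z r\<bar> \<le> \<rho>"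
      and d: "\<And>r. \<bar>Y r - Z r\<bar> \<le> d" "d \<ge> 0" and t: "t \<ge> 0" for Y Z d t
  proof -
    have "\<bar>Q Y s - Q Z s\<bar> \<le> k1 / 4 * d * exp (- \<mu> * s)" if s: "s \<ge> 0" for s
    proof -
      have "\<bar>Q Y s - Q Z s\<bar> \<le> (\<bar>0\<bar> + k1 * k2 / 8 * d / (k2 - \<mu>)) * exp (- \<mu> * s)"
        unfolding Q_def duhamel_diff[OF nnc[OF Y(1)] nnc[OF Z(1)]]
        using k d s by (intro duhamel_bound continuous_intros nnc nn_diff Y Z) (auto simp: \<mu>_def)
      also have "\<dots> \<le> k1 / 4 * d * exp (- \<mu> * s)"
        using gap[OF d(2)] by (intro mult_right_mono) auto
      finally show ?thesis .
    qed
    then have "\<bar>P Y t - P Z t\<bar> \<le> (\<bar>0\<bar> + k1 / 4 * d / (k1 - \<mu>)) * exp (- \<mu> * t)"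
      unfolding P_def duhamel_diff[OF Qc[OF Y(1)] Qc[OF Z(1)]]
      using k d t by (intro duhamel_bound continuous_intros Qc Y Z) (auto simp: \<mu>_def)
    also have "\<bar>0\<bar> + k1 / 4 * d / (k1 - \<mu>) = d / 2" using k by (simp add: \<mu>_def)
    finally show ?thesis .
  qed
  have S: "continuous_on UNIV (apply_bcontfun Z)" "\<bar>apply_bcontfun Z r\<bar> \<le> \<rho>" if "Z \<in> cball 0 \<rho>" for Z r
    using that norm_bounded[of Z r] by auto
  have cancel: "exp (\<mu> * t) * (c * exp (- \<mu> * t)) = c" for c t
    by (simp add: exp_minus)
  have A_bound: "norm (exp (\<mu> * max 0 t) * P (apply_bcontfun Z) (max 0 t)) \<le> \<rho>" if "Z \<in> cball 0 \<rho>" for Z t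
  proof -
    have "exp (\<mu> * max 0 t) * \<bar>P (apply_bcontfun Z) (max 0 t)\<bar>
        \<le> exp (\<mu> * max 0 t) * (\<rho> * exp (- \<mu> * max 0 t))"
      by (intro mult_left_mono P_bound S that) auto
    then show ?thesis unfolding cancel by (simp add: abs_mult)
  qed
  have A: "apply_bcontfun (A Z) t = exp (\<mu> * max 0 t) * P (apply_bcontfun Z) (max 0 t)" if "Z \<in> cball 0 \<rho>" for Z t
    unfolding A_def
  proof (subst Bcontfun_inverse)
    show "(\<lambda>t. exp (\<mu> * max 0 t) * P (apply_bcontfun Z) (max 0 t)) \<in> bcontfun"
    proof (rule bcontfun_normI[OF _ A_bound[OF that]])
      show "continuous_on UNIV (\<lambda>t. exp (\<mu> * max 0 t) * P (apply_bcontfun Z) (max 0 t))"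
        by (intro continuous_intros continuous_on_compose2[OF Pc[OF S(1)[OF that]]]) auto
    qed
  qed simp
  have "\<exists>!Z\<in>cball 0 \<rho>. A Z = Z"
  proof (rule Banach_fix)
    show "complete (cball 0 \<rho> :: (real \<Rightarrow>\<^sub>C real) set)" by (simp add: complete_eq_closed)
    show "cball 0 \<rho> \<noteq> ({} :: (real \<Rightarrow>\<^sub>C real) set)" using \<rho> by simp
    show "A ` cball 0 \<rho> \<subseteq> cball 0 \<rho>"
    proof safe
      fix Z :: "real \<Rightarrow>\<^sub>C real" assume Z: "Z \<in> cball 0 \<rho>"
      have "norm (A Z) \<le> \<rho>"
        by (rule norm_bound) (use A_bound[OF Z] A[OF Z] in simp)
      then show "A Z \<in> cball 0 \<rho>" by simp
    qed
    show "dist (A Y) (A Z) \<le> 1 / 2 * dist Y Z" if Y: "Y \<in> cball 0 \<rho>" and Z: "Z \<in> cball 0 \<rho>" for Y Z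
    proof (rule dist_bound)
      fix t
      have "\<bar>apply_bcontfun Y r - apply_bcontfun Z r\<bar> \<le> dist Y Z" for r
        using dist_bounded[of Y r Z] by (simp add: dist_real_def)
      then have "\<bar>P (apply_bcontfun Y) (max 0 t) - P (apply_bcontfun Z) (max 0 t)\<bar> \<le> dist Y Z / 2 * exp (- \<mu> * max 0 t)"
        by (intro P_diff S Y Z) auto
      then have "exp (\<mu> * max 0 t) * \<bar>P (apply_bcontfun Y) (max 0 t) - P (apply_bcontfun Z) (max 0 t)\<bar>
          \<le> exp (\<mu> * max 0 t) * (dist Y Z / 2 * exp (- \<mu> * max 0 t))"
        by (intro mult_left_mono) auto
      then show "dist (apply_bcontfun (A Y) t) (apply_bcontfun (A Z) t) \<le> 1 / 2 * dist Y Z"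
        unfolding cancel by (simp add: A[OF Y] A[OF Z] dist_real_def right_diff_distrib[symmetric] abs_mult)
    qed
  qed auto
  then obtain Z where Z: "Z \<in> cball 0 \<rho>" "A Z = Z" by blast
  define z where "z = P (apply_bcontfun Z)"
  define q where "q = Q (apply_bcontfun Z)"
  note Zc = S[OF Z(1)]
  \<comment> \<open>The fixed point equation undoes the weight: the nonlinearity evaluated at the
    weighted unknown is the nonlinearity along \<open>z\<close> itself.\<close>
  have nz: "nn (apply_bcontfun Z) t = n t (z t)" if "t \<ge> 0" for t
  proof -
    have "apply_bcontfun Z t = exp (\<mu> * t) * z t"
      using A[OF Z(1), of t] Z(2) that by (simp add: z_def)
    then show ?thesis by (simp add: nn_def mult.assoc[symmetric] exp_minus)
  qed
  have "(z has_real_derivative - k1 * z t + q t) (at t within {0..})" if "t \<ge> 0" for t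
    unfolding z_def q_def P_def using that by (intro duhamel_deriv Qc Zc)
  moreover have "(q has_real_derivative - k2 * q t + n t (z t)) (at t within {0..})" if "t \<ge> 0" for t
    unfolding q_def Q_def nz[OF that, symmetric] using that by (intro duhamel_deriv nnc Zc)
  moreover have "z 0 = z0" "q 0 = q0" by (simp_all add: z_def q_def P_def Q_def)
  moreover have "\<bar>z t\<bar> \<le> \<rho> * exp (- (k1 / 2) * t)" if "t \<ge> 0" for t
    using P_bound[OF Zc that] by (simp add: z_def \<mu>_def)
  moreover have "\<bar>q t\<bar> \<le> (\<bar>q0\<bar> + k1 / 4 * \<rho>) * exp (- (k1 / 2) * t)" if "t \<ge> 0" for t
    using Q_bound[OF Zc that] by (simp add: q_def \<mu>_def)
  ultimately show ?thesis by blast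
qed

section \<open>Existence and attraction\<close>

text \<open>Smallness makes the discriminant nonnegative. \<open>l2\<close> is the root in which the
  two terms of the numerator add up, so \<open>1 + d \<ge> 1\<close> gives its size. The ordering
  \<open>l2 \<le> l1\<close> says that in the stable case \<open>l1\<close> is the slower
  rate.\<close>

lemma characteristic_roots:
  fixes \<epsilon> a :: real
  assumes e: "\<epsilon> \<noteq> 0" and small: "4 * \<epsilon>\<^sup>2 * \<bar>a\<bar> \<le> 1"
  shows "\<exists>l1 l2. l1 + l2 = - 1 / \<epsilon> \<and> l1 * l2 = a \<and> 1 / \<bar>l2\<bar> \<le> 2 * \<bar>\<epsilon>\<bar> \<and> l2 \<noteq> 0 \<and>
           (\<epsilon> > 0 \<and> a > 0 \<longrightarrow> l1 < 0 \<and> l2 \<le> l1)"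
proof -
  define d where "d = sqrt (1 - 4 * \<epsilon>\<^sup>2 * a)"
  have "4 * \<epsilon>\<^sup>2 * a \<le> 4 * \<epsilon>\<^sup>2 * \<bar>a\<bar>" by (intro mult_left_mono) auto
  then have nonneg: "1 - 4 * \<epsilon>\<^sup>2 * a \<ge> 0" using small by linarith
  then have d: "d \<ge> 0" "d\<^sup>2 = 1 - 4 * \<epsilon>\<^sup>2 * a" by (simp_all add: d_def)
  define l1 where "l1 = - (1 - d) / (2 * \<epsilon>)"
  define l2 where "l2 = - (1 + d) / (2 * \<epsilon>)"
  have "l1 + l2 = - 1 / \<epsilon>" using e by (simp add: l1_def l2_def field_simps)
  moreover have "l1 * l2 = (1 - d\<^sup>2) / (4 * \<epsilon>\<^sup>2)"
    by (simp add: l1_def l2_def power2_eq_square algebra_simps)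
  then have "l1 * l2 = a" using e by (simp add: d)
  moreover have "l2 \<noteq> 0" using e d by (auto simp: l2_def)
  moreover have "1 / \<bar>l2\<bar> \<le> 2 * \<bar>\<epsilon>\<bar>"
  proof -
    have "1 / \<bar>l2\<bar> = 2 * \<bar>\<epsilon>\<bar> / (1 + d)" using d by (simp add: l2_def abs_mult)
    also have "\<dots> \<le> 2 * \<bar>\<epsilon>\<bar> / 1" using d by (intro divide_left_mono) auto
    finally show ?thesis by simp
  qed
  moreover have "l1 < 0 \<and> l2 \<le> l1" if "\<epsilon> > 0" "a > 0"
  proof -
    have "1 - 4 * \<epsilon>\<^sup>2 * a < 1" using that by simp
    then have "d < 1" unfolding d_def by (simp only: real_sqrt_lt_1_iff)
    then show ?thesis using d that by (simp add: l1_def l2_def field_simps)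
  qed
  ultimately show ?thesis by blast
qed

text \<open>The deviation \<open>z\<close> from \<open>x\<close> satisfies
  \<open>z'' + (k1 + k2) z' + k1 k2 z = n t z\<close>, where \<open>n\<close> is the linearization
  error of \<open>g\<close>. With \<open>q = z' + k1 z\<close> this is the triangular first-order
  system of \<open>stable_perturbation\<close>. The estimate on \<open>g\<close> is needed up to
  \<open>2 * \<rho>\<close> because \<open>x\<close> may be \<open>\<rho>\<close> away from
  \<open>c0\<close> and \<open>z\<close> adds another \<open>\<rho>\<close>.\<close>

lemma response_local_attractor:
  assumes g: "\<And>x. (g has_real_derivative deriv g x) (at x)" "\<And>x. isCont (deriv g) x"
    and e: "\<epsilon> > 0" and k: "k1 > 0" "k1 \<le> k2" "k1 + k2 = 1 / \<epsilon>" and \<rho>: "\<rho> > 0"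
    and lip: "\<And>u v. \<bar>u - c0\<bar> \<le> 2 * \<rho> \<Longrightarrow> \<bar>v - c0\<bar> \<le> 2 * \<rho> \<Longrightarrow>
       \<bar>g u - g v - k1 * k2 * (u - v)\<bar> \<le> k1 * k2 / 8 * \<bar>u - v\<bar>"
    and x: "solves_on \<epsilon> \<omega> g f UNIV x v" "\<And>t. \<bar>x t - c0\<bar> \<le> \<rho>"
  shows "local_attractor \<epsilon> \<omega> g f x v"
proof -
  \<comment> \<open>The quantity to be kept below \<open>\<rho> / 2\<close> is at most
    \<open>3 * \<bar>z0\<bar> + 2 / k1 * \<bar>b - v 0\<bar>\<close>, since \<open>q0\<close>
    contains \<open>k1 * z0\<close>; \<open>K\<close> dominates both coefficients.\<close>
  define K where "K = 3 + 2 / k1"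
  have kp: "K > 0" using k(1) by (simp add: K_def add_pos_pos)
  define \<delta> where "\<delta> = \<rho> / 2 / K"
  have "\<delta> > 0" using \<rho> kp by (simp add: \<delta>_def)
  define n where "n t z = k1 * k2 * z - (g (x t + z) - g (x t))" for t z
  have gc: "continuous_on UNIV g" by (rule DERIV_continuous_on) (rule g)
  have x': "(x has_real_derivative v t) (at t)" for t
    using x(1) by (simp add: solves_on_def)
  then have xc: "continuous_on UNIV x" by (rule DERIV_continuous_on)
  have nc: "continuous_on UNIV (\<lambda>(t, z). n t z)"
    unfolding n_def case_prod_beta
    by (intro continuous_intros continuous_on_compose2[OF gc] continuous_on_compose2[OF xc]) auto
  have nlip: "\<bar>n t y - n t z\<bar> \<le> k1 * k2 / 8 * \<bar>y - z\<bar>" if "\<bar>y\<bar> \<le> \<rho>" "\<bar>z\<bar> \<le> \<rho>" for t y z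
    using lip[of "x t + z" "x t + y"] x(2)[of t] that
    by (simp add: n_def algebra_simps abs_minus_commute)
  have exists: "\<exists>y w. solves_on \<epsilon> \<omega> g f {0..} y w \<and> y 0 = a \<and> w 0 = b \<and>
          ((\<lambda>t. \<bar>y t - x t\<bar> + \<bar>w t - v t\<bar>) \<longlongrightarrow> 0) at_top"
    if ab: "\<bar>a - x 0\<bar> + \<bar>b - v 0\<bar> < \<delta>" for a b
  proof -
    define z0 where "z0 = a - x 0"
    define q0 where "q0 = b - v 0 + k1 * z0"
    have "\<bar>z0\<bar> + 2 * \<bar>q0\<bar> / k1 \<le> \<rho> / 2"
    proof -
      have "\<bar>q0\<bar> \<le> \<bar>b - v 0\<bar> + k1 * \<bar>z0\<bar>"
        unfolding q0_def by (rule order_trans[OF abs_triangle_ineq]) (use k in \<open>simp add: abs_mult\<close>)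
      then have "2 * \<bar>q0\<bar> / k1 \<le> 2 * (\<bar>b - v 0\<bar> + k1 * \<bar>z0\<bar>) / k1"
        using k by (intro divide_right_mono mult_left_mono) auto
      also have "\<dots> = 2 / k1 * \<bar>b - v 0\<bar> + 2 * \<bar>z0\<bar>"
        using k by (simp add: field_simps)
      finally have "\<bar>z0\<bar> + 2 * \<bar>q0\<bar> / k1 \<le> 3 * \<bar>z0\<bar> + 2 / k1 * \<bar>b - v 0\<bar>" by linarith
      also have "\<dots> \<le> K * (\<bar>z0\<bar> + \<bar>b - v 0\<bar>)"
        using k by (simp add: K_def distrib_left distrib_right)
      also have "\<dots> \<le> K * \<delta>"
        using ab kp by (intro mult_left_mono) (auto simp: z0_def)
      also have "\<dots> = \<rho> / 2" using kp by (simp add: \<delta>_def)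
      finally show ?thesis .
    qed
    from stable_perturbation[OF k(1,2) \<rho> nc _ nlip this]
    obtain z q C where z: "z 0 = z0" "q 0 = q0"
      and z': "\<And>t. t \<ge> 0 \<Longrightarrow> (z has_real_derivative - k1 * z t + q t) (at t within {0..})"
      and q': "\<And>t. t \<ge> 0 \<Longrightarrow> (q has_real_derivative - k2 * q t + n t (z t)) (at t within {0..})"
      and zb: "\<And>t. t \<ge> 0 \<Longrightarrow> \<bar>z t\<bar> \<le> \<rho> * exp (- (k1 / 2) * t)"
      and qb: "\<And>t. t \<ge> 0 \<Longrightarrow> \<bar>q t\<bar> \<le> C * exp (- (k1 / 2) * t)"
      by (auto simp: n_def)
    define y where "y t = x t + z t" for t
    define w where "w t = v t + (- k1 * z t + q t)" for t
    have "solves_on \<epsilon> \<omega> g f {0..} y w"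
      unfolding solves_on_def
    proof (intro ballI conjI)
      fix t :: real assume "t \<in> {0..}"
      then have t: "t \<ge> 0" by simp
      show "(y has_real_derivative w t) (at t within {0..})"
        unfolding y_def w_def
        by (intro DERIV_add z' t has_field_derivative_at_within[OF x'])
      from x(1) obtain \<alpha> where \<alpha>: "(v has_real_derivative \<alpha>) (at t)" "\<epsilon> * \<alpha> + v t + \<epsilon> * g (x t) = \<epsilon> * f (t *\<^sub>R \<omega>)"
        by (auto simp: solves_on_def)
      have "(w has_real_derivative \<alpha> + (- k1 * (- k1 * z t + q t) + (- k2 * q t + n t (z t)))) (at t within {0..})"
        unfolding w_def
        by (intro DERIV_add DERIV_cmult z' q' t has_field_derivative_at_within[OF \<alpha>(1)])
      moreover have "\<alpha> + (- k1 * (- k1 * z t + q t) + (- k2 * q t + n t (z t))) =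
          \<alpha> - (k1 + k2) * (- k1 * z t + q t) - (g (y t) - g (x t))"
        by (simp add: n_def y_def algebra_simps)
      ultimately have "(w has_real_derivative \<alpha> - (k1 + k2) * (- k1 * z t + q t) - (g (y t) - g (x t))) (at t within {0..})"
        by (simp only:)
      moreover have "\<epsilon> * (\<alpha> - (k1 + k2) * (- k1 * z t + q t) - (g (y t) - g (x t))) + w t + \<epsilon> * g (y t) = \<epsilon> * f (t *\<^sub>R \<omega>)"
      proof -
        have "\<epsilon> * ((k1 + k2) * (- k1 * z t + q t)) = - k1 * z t + q t" using k(3) e by simp
        then show ?thesis
          using \<alpha>(2) unfolding right_diff_distrib w_def by linarith
      qed
      ultimately show "\<exists>\<beta>. (w has_real_derivative \<beta>) (at t within {0..}) \<and> \<epsilon> * \<beta> + w t + \<epsilon> * g (y t) = \<epsilon> * f (t *\<^sub>R \<omega>)"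
        by blast
    qed
    moreover have "y 0 = a" "w 0 = b"
      using z by (simp_all add: y_def w_def z0_def q0_def)
    moreover have "((\<lambda>t. \<bar>y t - x t\<bar> + \<bar>w t - v t\<bar>) \<longlongrightarrow> 0) at_top"
    proof (rule Lim_null_comparison)
      let ?B = "\<lambda>t. (\<rho> + (k1 * \<rho> + C)) * exp (- (k1 / 2) * t)"
      have "norm (\<bar>y t - x t\<bar> + \<bar>w t - v t\<bar>) \<le> ?B t" if t: "t \<ge> 0" for t
      proof -
        have "\<bar>y t - x t\<bar> + \<bar>w t - v t\<bar> \<le> \<bar>z t\<bar> + (k1 * \<bar>z t\<bar> + \<bar>q t\<bar>)"
          using abs_triangle_ineq[of "- k1 * z t" "q t"] k(1) by (simp add: y_def w_def abs_mult)
        also have "\<dots> \<le> \<rho> * exp (- (k1 / 2) * t) + (k1 * (\<rho> * exp (- (k1 / 2) * t)) + C * exp (- (k1 / 2) * t))"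
          using k(1) by (intro add_mono mult_left_mono zb qb t) auto
        also have "\<dots> = ?B t" by (simp add: distrib_right)
        finally show ?thesis by simp
      qed
      then show "\<forall>\<^sub>F t in at_top. norm (\<bar>y t - x t\<bar> + \<bar>w t - v t\<bar>) \<le> ?B t"
        by (auto intro!: eventually_at_top_linorderI)
      have "((\<lambda>t. exp (- (k1 / 2) * t)) \<longlongrightarrow> 0) at_top"
        by (rule filterlim_compose[OF exp_at_bot filterlim_tendsto_neg_mult_at_bot[OF tendsto_const _ filterlim_ident]])
          (use k in simp)
      from tendsto_mult_right_zero[OF this] show "(?B \<longlongrightarrow> 0) at_top" by simp
    qed
    ultimately show ?thesis by blast
  qed
  have unique: "z t = y t \<and> u t = w t"
    if "solves_on \<epsilon> \<omega> g f {0..} y w" "solves_on \<epsilon> \<omega> g f {0..<\<tau>} z u" "z 0 = y 0" "u 0 = w 0" "t \<in> {0..<\<tau>}"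
    for y w z u \<tau> t
    using that e by (intro solves_on_unique[OF g _ that(2) solves_on_subset[OF that(1)]]) auto
  show ?thesis
    unfolding local_attractor_def
  proof (intro exI[of _ \<delta>] conjI allI impI)
    fix a b assume "\<bar>a - x 0\<bar> + \<bar>b - v 0\<bar> < \<delta>"
    from exists[OF this] obtain y w where y: "solves_on \<epsilon> \<omega> g f {0..} y w" "y 0 = a" "w 0 = b"
      "((\<lambda>t. \<bar>y t - x t\<bar> + \<bar>w t - v t\<bar>) \<longlongrightarrow> 0) at_top" by blast
    have "\<forall>\<tau>>0. \<forall>z u. solves_on \<epsilon> \<omega> g f {0..<\<tau>} z u \<and> z 0 = a \<and> u 0 = b \<longrightarrow>
        (\<forall>t\<in>{0..<\<tau>}. z t = y t \<and> u t = w t)"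
    proof (intro allI impI ballI, elim conjE)
      fix \<tau> z u t
      assume "solves_on \<epsilon> \<omega> g f {0..<\<tau>} z u" "z 0 = a" "u 0 = b" "t \<in> {0..<\<tau>}"
      then show "z t = y t \<and> u t = w t"
        using y(2,3) by (intro unique[OF y(1), of \<tau> z u t]) simp_all
    qed
    with y show "\<exists>y w. solves_on \<epsilon> \<omega> g f {0..} y w \<and> y 0 = a \<and> w 0 = b \<and>
        (\<forall>\<tau>>0. \<forall>z u. solves_on \<epsilon> \<omega> g f {0..<\<tau>} z u \<and> z 0 = a \<and> u 0 = b \<longrightarrow>
          (\<forall>t\<in>{0..<\<tau>}. z t = y t \<and> u t = w t)) \<and>
        ((\<lambda>t. \<bar>y t - x t\<bar> + \<bar>w t - v t\<bar>) \<longlongrightarrow> 0) at_top"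
      by blast
  qed (rule \<open>\<delta> > 0\<close>)
qed

theorem theorem3:
  fixes \<omega> :: "real ^ 'd"
    and g :: "real \<Rightarrow> real"
    and f :: "real ^ 'd \<Rightarrow> real"
    and c0 :: real
  assumes "CARD('d) \<ge> 2"
    and "bryuno_condition \<omega>"
    and "real_analytic g"
    and "real_analytic_vec f"
    and "torus_periodic f"
    and "complex_of_real (g c0) = fourier_coeff f 0"
    and "deriv g c0 \<noteq> 0"
  shows "\<exists>\<epsilon>0>0. \<forall>\<epsilon>. \<bar>\<epsilon>\<bar> < \<epsilon>0 \<longrightarrow>
           (\<exists>x v. solves_on \<epsilon> \<omega> g f UNIV x v \<and> quasi_periodic \<omega> x \<and>
              (deriv g c0 > 0 \<and> \<epsilon> > 0 \<longrightarrow> local_attractor \<epsilon> \<omega> g f x v))"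
proof -
  note g = real_analytic_C1[OF assms(3)]
  have fc: "continuous_on UNIV f" by (rule real_analytic_vec_continuous) fact
  define a where "a = deriv g c0"
  have a: "a \<noteq> 0" using assms(7) by (simp add: a_def)
  \<comment> \<open>The tolerance \<open>\<bar>a\<bar> / 8\<close> is dictated by the stability
    contraction; the fixed point for the response gets by with
    \<open>\<bar>a\<bar> / 2\<close>.\<close>
  obtain \<rho>' where \<rho>': "\<rho>' > 0" "\<And>u v. \<bar>u - c0\<bar> \<le> \<rho>' \<Longrightarrow> \<bar>v - c0\<bar> \<le> \<rho>' \<Longrightarrow> \<bar>g u - g v - a * (u - v)\<bar> \<le> \<bar>a\<bar> / 8 * \<bar>u - v\<bar>"
    using C1_linearization[OF g, of "\<bar>a\<bar> / 8" c0] a by (auto simp: a_def)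
  define \<rho> where "\<rho> = \<rho>' / 2"
  have \<rho>: "\<rho> > 0" using \<rho>' by (simp add: \<rho>_def)
  have lip: "\<bar>g u - g v - a * (u - v)\<bar> \<le> \<bar>a\<bar> / 8 * \<bar>u - v\<bar>"
    if "\<bar>u - c0\<bar> \<le> 2 * \<rho>" "\<bar>v - c0\<bar> \<le> 2 * \<rho>" for u v
    using \<rho>'(2) that by (simp add: \<rho>_def)
  define F where "F \<psi> = f \<psi> - g c0" for \<psi>
  have F: "torus_fun F"
    using fc assms(5) by (auto simp: torus_fun_def torus_periodic_def F_def intro!: continuous_intros)
  \<comment> \<open>After division by \<open>\<bar>l1 * l2\<bar> = \<bar>a\<bar>\<close> the
    approximation error contributes \<open>\<rho> / 4\<close>, independently of \<epsilon>.\<close>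
  obtain Q M D where Q: "\<And>\<psi>. \<bar>Q \<psi>\<bar> \<le> M" "flow_deriv \<omega> Q D" "\<And>\<psi>. \<bar>F \<psi> - D \<psi>\<bar> \<le> \<bar>a\<bar> * \<rho> / 4"
    using approx_flow_derivative[OF fc assms(5) _ bryuno_condition_nonresonant[OF assms(2)] assms(6), of "\<bar>a\<bar> * \<rho> / 4"] a \<rho>
    unfolding F_def by auto
  have M: "M \<ge> 0" using Q(1)[of 0] by linarith
  define N where "N y = g (c0 + y) - g c0 - a * y" for y
  have gc: "continuous_on UNIV g" by (rule DERIV_continuous_on) (rule g)
  have Nc: "continuous_on UNIV N"
    unfolding N_def by (intro continuous_intros continuous_on_compose2[OF gc]) auto
  \<comment> \<open>The first entry makes
    \<open>4 * M * \<bar>\<epsilon>\<bar> \<le> \<rho> / 4\<close>, the remaining share of the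
    smallness budget, with \<open>M + 1\<close> guarding against \<open>M = 0\<close>. The second
    ensures real characteristic roots.\<close>
  define \<epsilon>0 where "\<epsilon>0 = min (\<rho> / (16 * (M + 1))) (1 / (2 * (1 + \<bar>a\<bar>)))"
  have "\<epsilon>0 > 0" using \<rho> M by (simp add: \<epsilon>0_def)
  moreover have "\<exists>x v. solves_on \<epsilon> \<omega> g f UNIV x v \<and> quasi_periodic \<omega> x \<and>
      (deriv g c0 > 0 \<and> \<epsilon> > 0 \<longrightarrow> local_attractor \<epsilon> \<omega> g f x v)" if e: "\<bar>\<epsilon>\<bar> < \<epsilon>0" for \<epsilon>
  proof (cases "\<epsilon> = 0")
    case True
    have "solves_on \<epsilon> \<omega> g f UNIV (\<lambda>_. c0) (\<lambda>_. 0)"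
      using True by (auto simp: solves_on_def intro!: exI[of _ 0])
    moreover have "quasi_periodic \<omega> (\<lambda>_. c0)"
      unfolding quasi_periodic_def by (intro exI[of _ "\<lambda>_. c0"]) (simp add: torus_periodic_def)
    ultimately show ?thesis using True by blast
  next
    case False
    have "4 * \<epsilon>\<^sup>2 * \<bar>a\<bar> \<le> 1"
    proof -
      have "\<bar>\<epsilon>\<bar> * (2 * (1 + \<bar>a\<bar>)) \<le> 1"
        using e by (simp add: \<epsilon>0_def field_simps)
      then have "(\<bar>\<epsilon>\<bar> * (2 * (1 + \<bar>a\<bar>)))\<^sup>2 \<le> 1"
        by (intro power_le_one) auto
      moreover have "\<bar>a\<bar> \<le> (1 + \<bar>a\<bar>)\<^sup>2" by (simp add: power2_eq_square algebra_simps)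
      then have "4 * \<epsilon>\<^sup>2 * \<bar>a\<bar> \<le> 4 * \<epsilon>\<^sup>2 * (1 + \<bar>a\<bar>)\<^sup>2" by (intro mult_left_mono) auto
      moreover have "(\<bar>\<epsilon>\<bar> * (2 * (1 + \<bar>a\<bar>)))\<^sup>2 = 4 * \<epsilon>\<^sup>2 * (1 + \<bar>a\<bar>)\<^sup>2"
        unfolding power_mult_distrib by simp
      ultimately show ?thesis by linarith
    qed
    then obtain l1 l2 where l: "l1 + l2 = - 1 / \<epsilon>" "l1 * l2 = a" "1 / \<bar>l2\<bar> \<le> 2 * \<bar>\<epsilon>\<bar>" "l2 \<noteq> 0"
      and stable: "\<epsilon> > 0 \<and> a > 0 \<longrightarrow> l1 < 0 \<and> l2 \<le> l1"
      using characteristic_roots[OF False] by blast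
    have l1: "l1 \<noteq> 0" using l(2) a by auto
    have "\<bar>resolvent \<omega> l2 (resolvent \<omega> l1 F) \<psi>\<bar> \<le> \<rho> / 2" for \<psi>
    proof -
      have "\<bar>resolvent \<omega> l2 (resolvent \<omega> l1 F) \<psi>\<bar> \<le> (2 * M + \<bar>a\<bar> * \<rho> / 4 / \<bar>l1\<bar>) / \<bar>l2\<bar>"
      proof (rule flow_linear_bound[OF l(4) _ flow_deriv_resolvent[OF l(4) torus_fun_resolvent[OF l1 F]]])
        \<comment> \<open>Some a priori bound is required as input; its value does not enter the
          estimate, so a chosen one will do.\<close>
        show "\<bar>resolvent \<omega> l2 (resolvent \<omega> l1 F) \<psi>\<bar> \<le>
            (SOME B. \<forall>\<psi>. \<bar>resolvent \<omega> l2 (resolvent \<omega> l1 F) \<psi>\<bar> \<le> B)" for \<psi>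
          using someI_ex[OF torus_fun_bounded[OF torus_fun_resolvent[OF l(4) torus_fun_resolvent[OF l1 F]]]] by blast
        show "\<bar>resolvent \<omega> l1 F \<psi>\<bar> \<le> 2 * M + \<bar>a\<bar> * \<rho> / 4 / \<bar>l1\<bar>" for \<psi>
          by (rule resolvent_bound_primitive[OF l1 F Q])
      qed
      also have "\<dots> = 2 * M * (1 / \<bar>l2\<bar>) + \<rho> / 4"
        using l(2,4) l1 by (simp add: add_divide_distrib flip: l(2)) (simp add: abs_mult)
      also have "\<dots> \<le> 2 * M * (2 * \<bar>\<epsilon>\<bar>) + \<rho> / 4"
        using M by (intro add_right_mono mult_left_mono l(3)) auto
      also have "\<dots> \<le> \<rho> / 2"
      proof -
        have "\<bar>\<epsilon>\<bar> * (16 * (M + 1)) \<le> \<rho>"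
          using e M by (simp add: \<epsilon>0_def field_simps)
        then have "16 * (M * \<bar>\<epsilon>\<bar>) + 16 * \<bar>\<epsilon>\<bar> \<le> \<rho>" by (simp add: algebra_simps)
        then show ?thesis by simp
      qed
      finally show ?thesis .
    qed
    moreover have "\<bar>N y - N z\<bar> \<le> \<bar>l1 * l2\<bar> / 2 * \<bar>y - z\<bar>" if "\<bar>y\<bar> \<le> \<rho>" "\<bar>z\<bar> \<le> \<rho>" for y z
    proof -
      have "N y - N z = g (c0 + y) - g (c0 + z) - a * ((c0 + y) - (c0 + z))"
        by (simp add: N_def algebra_simps)
      then have "\<bar>N y - N z\<bar> \<le> \<bar>a\<bar> / 8 * \<bar>y - z\<bar>"
        using lip[of "c0 + y" "c0 + z"] that \<rho> by simp
      also have "\<dots> \<le> \<bar>a\<bar> / 2 * \<bar>y - z\<bar>" by (intro mult_right_mono) auto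
      finally show ?thesis by (simp add: l(2))
    qed
    ultimately obtain Y q where Y: "torus_fun Y" "\<And>\<psi>. \<bar>Y \<psi>\<bar> \<le> \<rho>"
      and q': "flow_deriv \<omega> q (\<lambda>\<psi>. l1 * q \<psi> + (F \<psi> - N (Y \<psi>)))"
      and Y': "flow_deriv \<omega> Y (\<lambda>\<psi>. l2 * Y \<psi> + q \<psi>)"
      using response_fixed_point[OF l1 l(4) F Nc _ \<rho>, of \<omega>] by (auto simp: N_def)
    define x where "x t = c0 + Y (t *\<^sub>R \<omega>)" for t
    define v where "v t = l2 * Y (t *\<^sub>R \<omega>) + q (t *\<^sub>R \<omega>)" for t
    have YD: "((\<lambda>t. Y (t *\<^sub>R \<omega>)) has_real_derivative v t) (at t)" for t
      using Y'[unfolded flow_deriv_def, rule_format, of 0 t] by (simp add: v_def)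
    have qD: "((\<lambda>t. q (t *\<^sub>R \<omega>)) has_real_derivative l1 * q (t *\<^sub>R \<omega>) + (F (t *\<^sub>R \<omega>) - N (Y (t *\<^sub>R \<omega>)))) (at t)" for t
      using q'[unfolded flow_deriv_def, rule_format, of 0 t] by simp
    have sol: "solves_on \<epsilon> \<omega> g f UNIV x v"
      unfolding solves_on_def
    proof (intro ballI conjI)
      fix t
      show "(x has_real_derivative v t) (at t)"
        unfolding x_def using DERIV_add[OF DERIV_const[of c0] YD] by simp
      define \<beta> where "\<beta> = l2 * v t + (l1 * q (t *\<^sub>R \<omega>) + (F (t *\<^sub>R \<omega>) - N (Y (t *\<^sub>R \<omega>))))"
      have "(v has_real_derivative \<beta>) (at t)"
        unfolding v_def[abs_def] \<beta>_def by (intro DERIV_add DERIV_cmult qD YD[unfolded v_def])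
      moreover have "\<beta> = (l1 + l2) * v t - l1 * l2 * Y (t *\<^sub>R \<omega>) + (F (t *\<^sub>R \<omega>) - N (Y (t *\<^sub>R \<omega>)))"
        by (simp add: \<beta>_def v_def algebra_simps)
      \<comment> \<open>The term \<open>- a * Y\<close> from the product of the roots cancels the
        linear part split off in \<open>N\<close>, and the constants \<open>g c0\<close> in
        \<open>F\<close> and \<open>N\<close> cancel as well.\<close>
      then have "\<beta> = - v t / \<epsilon> + (f (t *\<^sub>R \<omega>) - g (x t))"
        by (simp add: l F_def N_def x_def)
      then have "\<epsilon> * \<beta> = - v t + \<epsilon> * (f (t *\<^sub>R \<omega>) - g (x t))"
        using False by (simp add: right_diff_distrib)
      then have "\<epsilon> * \<beta> + v t + \<epsilon> * g (x t) = \<epsilon> * f (t *\<^sub>R \<omega>)"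
        by (simp add: right_diff_distrib)
      ultimately show "\<exists>\<alpha>. (v has_real_derivative \<alpha>) (at t) \<and> \<epsilon> * \<alpha> + v t + \<epsilon> * g (x t) = \<epsilon> * f (t *\<^sub>R \<omega>)"
        by blast
    qed
    have "quasi_periodic \<omega> x"
      unfolding quasi_periodic_def using Y(1)
      by (intro exI[of _ "\<lambda>\<psi>. c0 + Y \<psi>"]) (auto simp: torus_fun_def torus_periodic_def x_def intro!: continuous_intros)
    moreover have "local_attractor \<epsilon> \<omega> g f x v" if pos: "deriv g c0 > 0" "\<epsilon> > 0"
    proof (rule response_local_attractor[OF g pos(2) _ _ _ \<rho> _ sol])
      have ap: "a > 0" using pos by (simp add: a_def)
      show "- l1 > 0" "- l1 \<le> - l2" using stable pos ap by auto
      show "- l1 + - l2 = 1 / \<epsilon>" using l(1) by (simp add: field_simps)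
      show "\<bar>x t - c0\<bar> \<le> \<rho>" for t using Y(2) by (simp add: x_def)
      show "\<bar>g u - g w - - l1 * - l2 * (u - w)\<bar> \<le> - l1 * - l2 / 8 * \<bar>u - w\<bar>"
        if "\<bar>u - c0\<bar> \<le> 2 * \<rho>" "\<bar>w - c0\<bar> \<le> 2 * \<rho>" for u w
        using lip[OF that] ap by (simp add: l(2))
    qed
    ultimately show ?thesis using sol by blast
  qed
  ultimately show ?thesis by blast
qed

end
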